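(* Assume that there exists $\varepsilon>0$ such that $$\sum_{n=1}^\infty \nu_n\left(\left[\frac{\varepsilon}{b_n},\infty\right)\right)<\infty$$ and additionally $$\sum_{n=1}^\infty b_n^2\int_{\{y\in\mathbb{R}:\ b_n|y|\le \varepsilon\}}|y|^2\,\nu_n(dy)<\infty .$$ Then the process $Y=(Y_t)_{t\in[0,1]}$, $Y_t=\sum_{n=1}^\infty\langle z,e_n\rangle X^{(n)}_t$, has a càdlàg modification.
   Context: $H$ is a real separable Hilbert space with orthonormal basis $(e_n)_{n\ge1}$ and $z\in H$ is fixed. For each $n$ let $\gamma_n>0$, $\sigma_n\ge0$, and let $\nu_n$ be a symmetric Borel measure on $\mathbb{R}$ with $\nu_n(\{0\})=0$ and $\int_{\mathbb{R}}(y^2\wedge1)\,\nu_n(dy)<\infty$. The processes $L^{(n)}=(L^{(n)}_t)_{t\ge0}$, $n\ge1$, are independent real-valued càdlàg symmetric Lévy processes without Gaussian part, with Lévy measures $\nu_n$, i.e. $\mathbf{E}e^{i\theta L^{(n)}_t}=\exp\{-t\int_{\mathbb{R}}(1-\cos(\theta y))\,\nu_n(dy)\}$. Set $$X^{(n)}_t=\int_0^t e^{-\gamma_n(t-s)}\sigma_n\,dL^{(n)}_s,\qquad b_n=|\sigma_n\langle z,e_n\rangle|,\qquad Y_t=\sum_{n=1}^\infty\langle z,e_n\rangle X^{(n)}_t,\quad t\in[0,1],$$ where $X^{(n)}$ is taken in its càdlàg version. The process $Y$ is considered when the series defining $Y_t$ converges almost surely for every $t\in[0,1]$. If $b_n=0$,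 then $[\varepsilon/b_n,\infty)$ is understood as the empty set and the $n$-th term of the second series as $0$. *)

theory Defs
  imports "HOL-Probability.Probability"
begin

definition cadlag_on :: "real set \<Rightarrow> (real \<Rightarrow> real) \<Rightarrow> bool" where
  "cadlag_on T f \<longleftrightarrow> (\<forall>t\<in>T. continuous (at t within (T \<inter> {t..})) f \<and>
     (\<exists>l. (f \<longlongrightarrow> l) (at t within (T \<inter> {..<t}))))"

definition has_cadlag_modification ::
    "'w measure \<Rightarrow> real set \<Rightarrow> (real \<Rightarrow> 'w \<Rightarrow> real) \<Rightarrow> bool" where
  "has_cadlag_modification M T Y \<longleftrightarrow> (\<exists>Z.
     (\<forall>t\<in>T. Z t \<in> borel_measurable M) \<and>
     (\<forall>t\<in>T. AE \<omega> in M. Z t \<omega> = Y t \<omega>) \<and>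
     (\<forall>\<omega>\<in>space M. cadlag_on T (\<lambda>t. Z t \<omega>)))"

text \<open>Path regularity and the initial value are required almost surely.\<close>

definition levy_process :: "'w measure \<Rightarrow> (real \<Rightarrow> 'w \<Rightarrow> real) \<Rightarrow> bool" where
  "levy_process M L \<longleftrightarrow>
     (\<forall>t\<ge>0. L t \<in> borel_measurable M) \<and>
     (AE \<omega> in M. L 0 \<omega> = 0) \<and>
     (\<forall>m (p::nat \<Rightarrow> real). 0 \<le> p 0 \<and> (\<forall>i<m. p i < p (Suc i)) \<longrightarrow>
        prob_space.indep_vars M (\<lambda>_. borel) (\<lambda>i \<omega>. L (p (Suc i)) \<omega> - L (p i) \<omega>) {..<m}) \<and>
     (\<forall>s\<ge>0. \<forall>h\<ge>0. distr M borel (\<lambda>\<omega>. L (s + h) \<omega> - L s \<omega>) = distr M borel (L h)) \<and>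
     (\<forall>t\<ge>0. \<forall>\<eta>>0. ((\<lambda>s. measure M {\<omega>\<in>space M. \<bar>L s \<omega> - L t \<omega>\<bar> > \<eta>}) \<longlongrightarrow> 0) (at t within {0..})) \<and>
     (AE \<omega> in M. cadlag_on {0..} (\<lambda>t. L t \<omega>))"

text \<open>The sigma-algebra on the path space is the one generated by the coordinate maps.\<close>

definition indep_processes :: "'w measure \<Rightarrow> (nat \<Rightarrow> real \<Rightarrow> 'w \<Rightarrow> real) \<Rightarrow> bool" where
  "indep_processes M L \<longleftrightarrow>
     prob_space.indep_vars M (\<lambda>_. PiM {0..} (\<lambda>_. borel)) (\<lambda>n \<omega>. \<lambda>t\<in>{0..}. L n t \<omega>) UNIV"

definition symmetric_levy_measure :: "real measure \<Rightarrow> bool" where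
  "symmetric_levy_measure \<nu> \<longleftrightarrow>
     sets \<nu> = sets borel \<and> distr \<nu> borel uminus = \<nu> \<and> emeasure \<nu> {0} = 0 \<and>
     (\<integral>\<^sup>+ y. ennreal (min (y\<^sup>2) 1) \<partial>\<nu>) < \<infinity>"

text \<open>The law of a symmetric Levy process with Levy measure \<open>\<nu>\<close> and no Gaussian part is
  specified by its characteristic function.\<close>

definition symmetric_pure_jump_levy_process ::
    "'w measure \<Rightarrow> real measure \<Rightarrow> (real \<Rightarrow> 'w \<Rightarrow> real) \<Rightarrow> bool" where
  "symmetric_pure_jump_levy_process M \<nu> L \<longleftrightarrow> levy_process M L \<and>
     (\<forall>t\<ge>0. \<forall>\<theta>. char (distr M borel (L t)) \<theta> =
        complex_of_real (exp (- t * (\<integral>y. 1 - cos (\<theta> * y) \<partial>\<nu>))))"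

definition partition_of :: "real \<Rightarrow> nat \<Rightarrow> (nat \<Rightarrow> real) \<Rightarrow> bool" where
  "partition_of t m p \<longleftrightarrow> p 0 = 0 \<and> p m = t \<and> (\<forall>i<m. p i < p (Suc i))"

text \<open>\<open>I\<close> is (a version of) the stochastic integral of the deterministic continuous
  integrand \<open>f\<close> with respect to \<open>L\<close> over \<open>(0, t]\<close>: the limit in probability, as the
  mesh of the partition tends to zero, of the nonanticipating (left endpoint) sums.
  It is determined up to almost sure equality.\<close>

definition is_stochastic_integral ::
    "'w measure \<Rightarrow> (real \<Rightarrow> real) \<Rightarrow> (real \<Rightarrow> 'w \<Rightarrow> real) \<Rightarrow> real \<Rightarrow> ('w \<Rightarrow> real) \<Rightarrow> bool" where
  "is_stochastic_integral M f L t I \<longleftrightarrow> I \<in> borel_measurable M \<and>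
     (\<forall>\<eta>>0. \<forall>\<kappa>>0. \<exists>\<delta>>0. \<forall>m p.
        partition_of t m p \<and> (\<forall>i<m. p (Suc i) - p i < \<delta>) \<longrightarrow>
        measure M {\<omega>\<in>space M. \<bar>(\<Sum>i<m. f (p i) * (L (p (Suc i)) \<omega> - L (p i) \<omega>)) - I \<omega>\<bar> > \<eta>} < \<kappa>)"

definition orthonormal_basis :: "(nat \<Rightarrow> 'h::real_inner) \<Rightarrow> bool" where
  "orthonormal_basis e \<longleftrightarrow>
     (\<forall>i j. e i \<bullet> e j = (if i = j then 1 else 0)) \<and> closure (span (range e)) = UNIV"

end

theory Submission
  imports Defs
begin

text \<open>
  Write \<open>a n = \<sigma> n * (z \<bullet> e n)\<close>, so that \<open>b n = \<bar>a n\<bar>\<close>. The partial sums of the series for \<open>Y\<close> have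
  cadlag paths, and uniform limits of cadlag paths are cadlag. It therefore suffices that the partial
  sums converge uniformly on \<open>[0, 1]\<close>, almost surely and along some subsequence. By Borel-Cantelli this
  follows from a maximal inequality for finite blocks \<open>F\<close> of the series: the probability that
  \<open>\<bar>\<Sum>n\<in>F. (z \<bullet> e n) * X n t\<bar>\<close> exceeds \<open>\<eta>\<close> for some dyadic \<open>t \<in> [0, 1]\<close> is at most
  \<open>(3 + 384 / \<eta>\<^sup>2) * (\<Sum>n\<in>F. \<kappa> n)\<close>, where \<open>\<kappa> n\<close> is the integral of \<open>min 1 ((b n * y)\<^sup>2)\<close> with
  respect to \<open>\<nu> n\<close> (\<open>prob_dyadic_le\<close>). Right-continuity extends the estimate to all of \<open>[0, 1]\<close>, and the
  two conditions on the Levy measures make \<open>\<kappa>\<close> summable. The difficulty is that the constants must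
  not depend on the rates \<open>\<gamma> n\<close>, which may be unbounded.

  The rates are removed by a convexity argument. On a grid of mesh \<open>h\<close> the convolutions become sums of
  terms \<open>exp (- \<gamma> n * (j - i) * h) * \<xi> (n, i)\<close> over \<open>n\<close> and \<open>i < j\<close>, where the variables \<open>\<xi> (n, i)\<close>, the
  increments of \<open>a n * L n\<close>, are independent and symmetric. The weight \<open>1 - exp (- \<gamma> n * l * h)\<close> is
  nondecreasing in the lag \<open>l\<close>, hence a mixture of the thresholds \<open>l > \<tau>\<close>: a decaying contribution is
  an average of contributions that are switched off after a delay. For fixed delays \<open>\<tau> n\<close> one is left
  with the sum of \<open>\<xi> (n, i)\<close> over \<open>i + \<tau> n < j\<close>. As \<open>j\<close> grows this is a sum of independent centred
  variables each of which arrives at some time, so Doob's inequality applies with a constant that does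
  not see the delays (\<open>expectation_MAX_square_le\<close>). The second moment of a maximum is convex, so the
  bound passes to the mixture (\<open>filtered_sum_MAX_square_le\<close>).

  The increments may lack second moments, so they are truncated at 1; symmetry keeps them centred. Both
  the variance of the truncated increments and the probability that some increment is truncated are
  controlled by the expectation of \<open>min 1 (\<xi>\<^sup>2)\<close>, which is at most \<open>3 * h * \<kappa> n\<close>. This is read off from
  the characteristic function, by averaging \<open>1 - cos\<close> over a Gaussian frequency
  (\<open>nn_integral_min_square_le\<close>). Finally the grid sums converge in probability to the stochastic
  integrals as the mesh tends to zero.
\<close>

section \<open>A maximal inequality for independent variables arriving in any order\<close>

text \<open>A pathwise form of Doob's \<open>L\<^sup>2\<close> inequality: under expectation the sum on the right vanishes when \<open>s\<close>
  is a martingale, because each \<open>R k\<close> depends only on the past. It rests on the observation that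
  \<open>R\<close> can grow only at a time when \<open>s\<close> itself attains the new maximum.\<close>

lemma running_max_square_le:
  fixes s :: "nat \<Rightarrow> real"
  defines "R \<equiv> \<lambda>k. MAX j\<in>{..k}. s j"
  shows "(R m)\<^sup>2 \<le> 4 * (s m)\<^sup>2 - 4 * (\<Sum>k<m. R k * (s (Suc k) - s k))"
proof -
  have R_Suc: "R (Suc k) = max (s (Suc k)) (R k)" for k
    unfolding R_def by (subst atMost_Suc) simp
  \<comment> \<open>Summation by parts, carried out by induction; the product \<open>R m * s m\<close> is absorbed afterwards.\<close>
  have "(R m)\<^sup>2 \<le> 2 * (R m * s m) - 2 * (\<Sum>k<m. R k * (s (Suc k) - s k))"
  proof (induction m)
    case 0
    show ?case by (simp add: R_def power2_eq_square)
  next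
    case (Suc m)
    have "(R (Suc m))\<^sup>2 - (R m)\<^sup>2 \<le> 2 * (s (Suc m) * (R (Suc m) - R m))"
    proof (cases "R m \<le> s (Suc m)")
      case True
      then have "R (Suc m) = s (Suc m)" by (simp add: R_Suc)
      moreover have "0 \<le> (s (Suc m) - R m)\<^sup>2" by simp
      ultimately show ?thesis by (simp add: power2_eq_square algebra_simps)
    qed (simp add: R_Suc)
    with Suc show ?case by (simp add: algebra_simps)
  qed
  moreover have "2 * (R m * s m) \<le> (R m)\<^sup>2 / 2 + 2 * (s m)\<^sup>2"
  proof -
    have "0 \<le> (R m - 2 * s m)\<^sup>2" by simp
    then show ?thesis by (simp add: power2_eq_square algebra_simps)
  qed
  ultimately show ?thesis by simp
qed

lemma integrable_MAX:
  fixes f :: "'i \<Rightarrow> 'w \<Rightarrow> real"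
  assumes "finite A" "A \<noteq> {}" "\<And>j. j \<in> A \<Longrightarrow> integrable M (f j)"
  shows "integrable M (\<lambda>\<omega>. MAX j\<in>A. f j \<omega>)"
  using assms by (induction A rule: finite_ne_induct) (auto intro: integrable_max)

lemma integrable_sum_square:
  fixes \<zeta> :: "'i \<Rightarrow> 'w \<Rightarrow> real"
  assumes [measurable]: "\<And>x. x \<in> J \<Longrightarrow> \<zeta> x \<in> borel_measurable M"
    and sq: "\<And>x. x \<in> J \<Longrightarrow> integrable M (\<lambda>\<omega>. (\<zeta> x \<omega>)\<^sup>2)"
  shows "integrable M (\<lambda>\<omega>. (\<Sum>x\<in>J. c x * \<zeta> x \<omega>)\<^sup>2)"
proof -
  have "integrable M (\<lambda>\<omega>. (c x * \<zeta> x \<omega>) * (c y * \<zeta> y \<omega>))" if "x \<in> J" "y \<in> J" for x y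
  proof -
    have "integrable M (\<lambda>\<omega>. \<zeta> x \<omega> * \<zeta> y \<omega>)"
    proof (rule Bochner_Integration.integrable_bound)
      show "integrable M (\<lambda>\<omega>. (\<zeta> x \<omega>)\<^sup>2 + (\<zeta> y \<omega>)\<^sup>2)" using sq that by simp
      have "\<bar>u * v\<bar> \<le> u\<^sup>2 + v\<^sup>2" for u v :: real
      proof -
        have "0 \<le> (\<bar>u\<bar> - \<bar>v\<bar>)\<^sup>2" "0 \<le> u\<^sup>2" "0 \<le> v\<^sup>2" by simp_all
        moreover have "0 \<le> \<bar>u\<bar> * \<bar>v\<bar>" by simp
        ultimately show ?thesis unfolding power2_diff power2_abs abs_mult by linarith
      qed
      then show "AE \<omega> in M. norm (\<zeta> x \<omega> * \<zeta> y \<omega>) \<le> norm ((\<zeta> x \<omega>)\<^sup>2 + (\<zeta> y \<omega>)\<^sup>2)"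
        by simp
    qed (use that in measurable)
    from integrable_mult_right[OF this, of "c x * c y"] show ?thesis
      by (simp add: mult_ac)
  qed
  then show ?thesis
    by (simp add: power2_eq_square sum_product)
qed

context prob_space
begin

text \<open>This plays the role of the martingale property of the partial sums.\<close>

lemma indep_centred_orthogonal:
  fixes \<zeta> :: "'i \<Rightarrow> 'a \<Rightarrow> real"
  assumes ind: "indep_vars (\<lambda>_. borel) \<zeta> I" and x: "x \<in> I" and A: "A \<subseteq> I - {x}"
    and int: "integrable M (\<zeta> x)" and mean: "expectation (\<zeta> x) = 0"
    and g: "g \<in> borel_measurable (PiM A (\<lambda>_. borel))"
    and intg: "integrable M (\<lambda>\<omega>. g (\<lambda>y\<in>A. \<zeta> y \<omega>))"
  shows "integrable M (\<lambda>\<omega>. g (\<lambda>y\<in>A. \<zeta> y \<omega>) * \<zeta> x \<omega>)"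
    and "expectation (\<lambda>\<omega>. g (\<lambda>y\<in>A. \<zeta> y \<omega>) * \<zeta> x \<omega>) = 0"
proof -
  have "indep_var (PiM A (\<lambda>_. borel)) (\<lambda>\<omega>. \<lambda>y\<in>A. \<zeta> y \<omega>)
          (PiM {x} (\<lambda>_. borel)) (\<lambda>\<omega>. \<lambda>y\<in>{x}. \<zeta> y \<omega>)"
    by (rule indep_var_restrict[OF ind]) (use x A in auto)
  then have "indep_var borel (g \<circ> (\<lambda>\<omega>. \<lambda>y\<in>A. \<zeta> y \<omega>))
               borel ((\<lambda>f. f x) \<circ> (\<lambda>\<omega>. \<lambda>y\<in>{x}. \<zeta> y \<omega>))"
    by (rule indep_var_compose[OF _ g]) simp
  then have iv: "indep_var borel (\<lambda>\<omega>. g (\<lambda>y\<in>A. \<zeta> y \<omega>)) borel (\<zeta> x)"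
    by (simp add: comp_def)
  show "integrable M (\<lambda>\<omega>. g (\<lambda>y\<in>A. \<zeta> y \<omega>) * \<zeta> x \<omega>)"
    by (rule indep_var_integrable[OF iv intg int])
  show "expectation (\<lambda>\<omega>. g (\<lambda>y\<in>A. \<zeta> y \<omega>) * \<zeta> x \<omega>) = 0"
    using indep_var_lebesgue_integral[OF iv intg int] mean by simp
qed

lemma expectation_square_indep_sum:
  fixes \<zeta> :: "'i \<Rightarrow> 'a \<Rightarrow> real"
  assumes fin: "finite J" and ind: "indep_vars (\<lambda>_. borel) \<zeta> J"
    and sq: "\<And>x. x \<in> J \<Longrightarrow> integrable M (\<lambda>\<omega>. (\<zeta> x \<omega>)\<^sup>2)"
    and mean: "\<And>x. x \<in> J \<Longrightarrow> expectation (\<zeta> x) = 0"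
  shows "expectation (\<lambda>\<omega>. (\<Sum>x\<in>J. \<zeta> x \<omega>)\<^sup>2) = (\<Sum>x\<in>J. expectation (\<lambda>\<omega>. (\<zeta> x \<omega>)\<^sup>2))"
proof -
  have meas: "\<zeta> x \<in> borel_measurable M" if "x \<in> J" for x
    using ind that by (auto simp: indep_vars_def)
  have int: "integrable M (\<zeta> x)" if "x \<in> J" for x
    using square_integrable_imp_integrable[OF meas sq] that by blast
  have off: "integrable M (\<lambda>\<omega>. \<zeta> y \<omega> * \<zeta> x \<omega>) \<and> expectation (\<lambda>\<omega>. \<zeta> y \<omega> * \<zeta> x \<omega>) = 0"
    if "x \<in> J" "y \<in> J" "x \<noteq> y" for x y
    using indep_centred_orthogonal[OF ind that(1), of "{y}" "\<lambda>f. f y"] that int mean by auto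
  have prod: "integrable M (\<lambda>\<omega>. \<zeta> y \<omega> * \<zeta> x \<omega>)" if "x \<in> J" "y \<in> J" for x y
    using off[OF that] sq that by (cases "x = y") (auto simp: power2_eq_square)
  have "expectation (\<lambda>\<omega>. (\<Sum>x\<in>J. \<zeta> x \<omega>)\<^sup>2)
      = (\<Sum>x\<in>J. \<Sum>y\<in>J. expectation (\<lambda>\<omega>. \<zeta> x \<omega> * \<zeta> y \<omega>))"
    using prod by (simp add: power2_eq_square sum_product)
  also have "\<dots> = (\<Sum>x\<in>J. \<Sum>y\<in>J. if y = x then expectation (\<lambda>\<omega>. (\<zeta> x \<omega>)\<^sup>2) else 0)"
    using off by (intro sum.cong refl) (auto simp: power2_eq_square)
  finally show ?thesis using fin by simp
qed

text \<open>The time index of the partial sums is unrelated to the indexing of the family: \<open>a x\<close> is the time at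
  which the variable \<open>\<zeta> x\<close> enters the sum. Several variables may enter together, and the bound does
  not depend on \<open>a\<close>; this is what later makes the constants independent of the delays.\<close>

lemma expectation_MAX_square_le:
  fixes \<zeta> :: "'i \<Rightarrow> 'a \<Rightarrow> real" and a :: "'i \<Rightarrow> nat"
  assumes fin: "finite I" and ind: "indep_vars (\<lambda>_. borel) \<zeta> I"
    and sq: "\<And>x. x \<in> I \<Longrightarrow> integrable M (\<lambda>\<omega>. (\<zeta> x \<omega>)\<^sup>2)"
    and mean: "\<And>x. x \<in> I \<Longrightarrow> expectation (\<zeta> x) = 0"
  defines "T \<equiv> \<lambda>j \<omega>. \<Sum>x\<in>{x\<in>I. a x < j}. \<zeta> x \<omega>"
  shows "integrable M (\<lambda>\<omega>. (MAX j\<in>{..m}. T j \<omega>)\<^sup>2)"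
    and "expectation (\<lambda>\<omega>. (MAX j\<in>{..m}. T j \<omega>)\<^sup>2)
           \<le> 4 * (\<Sum>x\<in>I. expectation (\<lambda>\<omega>. (\<zeta> x \<omega>)\<^sup>2))"
proof -
  define R where "R k \<omega> = (MAX j\<in>{..k}. T j \<omega>)" for k \<omega>
  have meas[measurable]: "\<zeta> x \<in> borel_measurable M" if "x \<in> I" for x
    using ind that by (auto simp: indep_vars_def)
  have int: "integrable M (\<zeta> x)" if "x \<in> I" for x
    using square_integrable_imp_integrable[OF meas sq] that by blast
  have T_int: "integrable M (T j)" for j
    unfolding T_def by (intro Bochner_Integration.integrable_sum) (auto intro: int)
  have T_sq: "integrable M (\<lambda>\<omega>. (T j \<omega>)\<^sup>2)" for j
    using integrable_sum_square[of "{x\<in>I. a x < j}" \<zeta> M "\<lambda>_. 1"] meas sq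
    unfolding T_def by simp
  have R_int: "integrable M (R k)" for k
    unfolding R_def by (intro integrable_MAX) (auto intro: T_int)
  show R_sq: "integrable M (\<lambda>\<omega>. (MAX j\<in>{..m}. T j \<omega>)\<^sup>2)"
  proof (rule Bochner_Integration.integrable_bound)
    show "integrable M (\<lambda>\<omega>. \<Sum>j\<le>m. (T j \<omega>)\<^sup>2)"
      by (intro Bochner_Integration.integrable_sum T_sq)
    have "(MAX j\<in>{..m}. T j \<omega>)\<^sup>2 \<le> (\<Sum>j\<le>m. (T j \<omega>)\<^sup>2)" for \<omega>
    proof -
      have "(MAX j\<in>{..m}. T j \<omega>) \<in> (\<lambda>j. T j \<omega>) ` {..m}" by (intro Max_in) auto
      then obtain j where "j \<le> m" "(MAX j\<in>{..m}. T j \<omega>) = T j \<omega>" by blast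
      then show ?thesis by (auto intro!: member_le_sum[of j "{..m}" "\<lambda>j. (T j \<omega>)\<^sup>2"])
    qed
    then show "AE \<omega> in M. norm ((MAX j\<in>{..m}. T j \<omega>)\<^sup>2) \<le> norm (\<Sum>j\<le>m. (T j \<omega>)\<^sup>2)"
      by (auto simp: sum_nonneg)
  qed (use R_int[of m] in \<open>simp add: R_def[abs_def]\<close>)
  have step: "integrable M (\<lambda>\<omega>. R k \<omega> * (T (Suc k) \<omega> - T k \<omega>)) \<and>
      expectation (\<lambda>\<omega>. R k \<omega> * (T (Suc k) \<omega> - T k \<omega>)) = 0" for k
  proof -
    define g where "g f = (MAX j\<in>{..k}. \<Sum>x\<in>{x\<in>I. a x < j}. f x)" for f :: "'i \<Rightarrow> real"
    define A where "A = {x\<in>I. a x < k}"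
    have g_meas: "g \<in> borel_measurable (PiM A (\<lambda>_. borel))"
      unfolding g_def[abs_def]
      by (intro borel_measurable_Max borel_measurable_sum)
         (auto simp: A_def intro!: measurable_component_singleton)
    have R_eq: "R k = (\<lambda>\<omega>. g (\<lambda>y\<in>A. \<zeta> y \<omega>))"
      unfolding R_def g_def T_def A_def
      by (intro ext arg_cong[where f = Max] image_cong sum.cong refl) auto
    have D: "T (Suc k) \<omega> - T k \<omega> = (\<Sum>x\<in>{x\<in>I. a x = k}. \<zeta> x \<omega>)" for \<omega>
    proof -
      have "{x\<in>I. a x < Suc k} = {x\<in>I. a x < k} \<union> {x\<in>I. a x = k}" by auto
      then show ?thesis
        unfolding T_def using fin by (simp add: sum.union_disjoint disjoint_iff)
    qed
    have "integrable M (\<lambda>\<omega>. R k \<omega> * \<zeta> x \<omega>) \<and> expectation (\<lambda>\<omega>. R k \<omega> * \<zeta> x \<omega>) = 0"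
      if "x \<in> I" "a x = k" for x
      using indep_centred_orthogonal[OF ind that(1) _ int mean g_meas] R_int[of k] that
      by (auto simp: R_eq A_def)
    note orth = this
    have "expectation (\<lambda>\<omega>. \<Sum>x\<in>{x\<in>I. a x = k}. R k \<omega> * \<zeta> x \<omega>)
        = (\<Sum>x\<in>{x\<in>I. a x = k}. expectation (\<lambda>\<omega>. R k \<omega> * \<zeta> x \<omega>))"
      using orth by (intro Bochner_Integration.integral_sum) auto
    moreover have "integrable M (\<lambda>\<omega>. \<Sum>x\<in>{x\<in>I. a x = k}. R k \<omega> * \<zeta> x \<omega>)"
      using orth by (intro Bochner_Integration.integrable_sum) auto
    ultimately show ?thesis using orth unfolding D sum_distrib_left by simp
  qed
  have "expectation (\<lambda>\<omega>. (R m \<omega>)\<^sup>2)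
      \<le> expectation (\<lambda>\<omega>. 4 * (T m \<omega>)\<^sup>2 - 4 * (\<Sum>k<m. R k \<omega> * (T (Suc k) \<omega> - T k \<omega>)))"
    using R_sq step T_sq running_max_square_le[of "\<lambda>j. T j _" m]
    by (intro integral_mono) (auto simp: R_def)
  also have "\<dots> = 4 * expectation (\<lambda>\<omega>. (T m \<omega>)\<^sup>2)"
    using step T_sq by simp
  also have "expectation (\<lambda>\<omega>. (T m \<omega>)\<^sup>2) = (\<Sum>x\<in>{x\<in>I. a x < m}. expectation (\<lambda>\<omega>. (\<zeta> x \<omega>)\<^sup>2))"
    unfolding T_def
    by (rule expectation_square_indep_sum) (use fin sq mean in \<open>auto intro: indep_vars_subset[OF ind]\<close>)
  also have "\<dots> \<le> (\<Sum>x\<in>I. expectation (\<lambda>\<omega>. (\<zeta> x \<omega>)\<^sup>2))"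
    using fin by (intro sum_mono2) auto
  finally show "expectation (\<lambda>\<omega>. (MAX j\<in>{..m}. T j \<omega>)\<^sup>2)
           \<le> 4 * (\<Sum>x\<in>I. expectation (\<lambda>\<omega>. (\<zeta> x \<omega>)\<^sup>2))"
    by (simp add: R_def)
qed

end

section \<open>Convolution with monotone kernels\<close>

lemma MAX_square_le:
  fixes f :: "'j \<Rightarrow> real"
  assumes "finite A" "A \<noteq> {}" "0 \<le> (MAX j\<in>A. f j)" "0 \<le> (MAX j\<in>A. - f j)"
  shows "(MAX j\<in>A. (f j)\<^sup>2) \<le> (MAX j\<in>A. f j)\<^sup>2 + (MAX j\<in>A. - f j)\<^sup>2"
proof (rule Max.boundedI)
  fix x assume "x \<in> (\<lambda>j. (f j)\<^sup>2) ` A"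
  then obtain j where j: "j \<in> A" "x = (f j)\<^sup>2" by auto
  have "f j \<le> (MAX j\<in>A. f j)" "- f j \<le> (MAX j\<in>A. - f j)"
    using assms j by (auto intro!: Max_ge)
  then have "(f j)\<^sup>2 \<le> (MAX j\<in>A. f j)\<^sup>2 \<or> (f j)\<^sup>2 \<le> (MAX j\<in>A. - f j)\<^sup>2"
    using assms(3,4) by (cases "0 \<le> f j") (auto simp: abs_le_square_iff[symmetric])
  then show "x \<le> (MAX j\<in>A. f j)\<^sup>2 + (MAX j\<in>A. - f j)\<^sup>2"
    using j by (auto intro: add_increasing add_increasing2)
qed (use assms in auto)

lemma convex_sum_square_le:
  fixes w x :: "'q \<Rightarrow> real"
  assumes "finite A" "\<And>q. q \<in> A \<Longrightarrow> 0 \<le> w q" "sum w A \<le> 1"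
  shows "(\<Sum>q\<in>A. w q * x q)\<^sup>2 \<le> (\<Sum>q\<in>A. w q * (x q)\<^sup>2)"
proof -
  have "(\<Sum>q\<in>A. sqrt (w q) * (sqrt (w q) * x q))\<^sup>2
      \<le> (\<Sum>q\<in>A. (sqrt (w q))\<^sup>2) * (\<Sum>q\<in>A. (sqrt (w q) * x q)\<^sup>2)"
    by (rule Cauchy_Schwarz_ineq_sum)
  also have "(\<Sum>q\<in>A. sqrt (w q) * (sqrt (w q) * x q)) = (\<Sum>q\<in>A. w q * x q)"
    using assms(2) by (intro sum.cong refl) (simp add: mult.assoc[symmetric])
  also have "(\<Sum>q\<in>A. (sqrt (w q))\<^sup>2) = sum w A"
    using assms(2) by (intro sum.cong refl) simp
  also have "(\<Sum>q\<in>A. (sqrt (w q) * x q)\<^sup>2) = (\<Sum>q\<in>A. w q * (x q)\<^sup>2)"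
    using assms(2) by (intro sum.cong refl) (simp add: power_mult_distrib)
  also have "sum w A * (\<Sum>q\<in>A. w q * (x q)\<^sup>2) \<le> 1 * (\<Sum>q\<in>A. w q * (x q)\<^sup>2)"
    using assms by (intro mult_right_mono sum_nonneg) auto
  finally show ?thesis by simp
qed

text \<open>For a nondecreasing kernel the weights of the thresholds are nonnegative, and by telescoping their
  sum \<open>\<beta> m\<close> is at most 1 if the kernel is bounded by 1.\<close>

lemma monotone_eq_sum_indicators:
  fixes \<beta> :: "nat \<Rightarrow> real"
  assumes "\<beta> 0 = 0" "l \<le> m"
  shows "\<beta> l = (\<Sum>q<m. (\<beta> (Suc q) - \<beta> q) * of_bool (q < l))"
proof -
  have "(\<Sum>q<m. (\<beta> (Suc q) - \<beta> q) * of_bool (q < l)) = (\<Sum>q<l. \<beta> (Suc q) - \<beta> q)"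
    using assms(2) by (intro sum.mono_neutral_cong_right) auto
  also have "\<dots> = \<beta> l" using assms(1) by (simp add: sum_lessThan_telescope)
  finally show ?thesis by simp
qed

text \<open>The discrete convolution of each row \<open>i \<mapsto> \<zeta> (n, i)\<close> with its own kernel \<open>\<beta> n\<close>, summed over the rows.
  The sum runs over all \<open>i < m\<close>: causality is obtained from kernels with \<open>\<beta> n 0 = 0\<close>, as the
  truncated difference \<open>j - i\<close> vanishes for \<open>i \<ge> j\<close>.\<close>

definition filtered_sum ::
    "'n set \<Rightarrow> nat \<Rightarrow> ('n \<Rightarrow> nat \<Rightarrow> real) \<Rightarrow> ('n \<times> nat \<Rightarrow> 'w \<Rightarrow> real) \<Rightarrow> nat \<Rightarrow> 'w \<Rightarrow> real" where
  "filtered_sum F m \<beta> \<zeta> j \<omega> = (\<Sum>(n, i)\<in>F \<times> {..<m}. \<beta> n (j - i) * \<zeta> (n, i) \<omega>)"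

context prob_space
begin

lemma integrable_MAX_filtered_sum_square:
  assumes ind: "indep_vars (\<lambda>_. borel) \<zeta> (F \<times> {..<m})"
    and sq: "\<And>x. x \<in> F \<times> {..<m} \<Longrightarrow> integrable M (\<lambda>\<omega>. (\<zeta> x \<omega>)\<^sup>2)"
  shows "integrable M (\<lambda>\<omega>. MAX j\<in>{..m}. (filtered_sum F m \<beta> \<zeta> j \<omega>)\<^sup>2)"
proof -
  have "\<zeta> x \<in> borel_measurable M" if "x \<in> F \<times> {..<m}" for x
    using ind that by (auto simp: indep_vars_def)
  then have "integrable M (\<lambda>\<omega>. (filtered_sum F m \<beta> \<zeta> j \<omega>)\<^sup>2)" for j
    using integrable_sum_square[of "F \<times> {..<m}" \<zeta> M "\<lambda>(n, i). \<beta> n (j - i)"] sq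
    by (simp add: filtered_sum_def case_prod_unfold)
  then show ?thesis by (intro integrable_MAX) auto
qed

text \<open>The second moment of the maximum is a convex function of the kernels. A nondecreasing kernel with
  values in \<open>[0, 1]\<close> is a mixture of threshold kernels, so it is enough to bound the case in which
  all kernels are thresholds \<open>l > \<tau> n\<close>. In that case \<open>\<zeta> (n, i)\<close> is simply a variable that arrives at
  time \<open>i + \<tau> n\<close>.\<close>

lemma filtered_sum_MAX_square_le:
  fixes \<zeta> :: "'n \<times> nat \<Rightarrow> 'a \<Rightarrow> real"
  assumes fin: "finite F" and ind: "indep_vars (\<lambda>_. borel) \<zeta> (F \<times> {..<m})"
    and sq: "\<And>x. x \<in> F \<times> {..<m} \<Longrightarrow> integrable M (\<lambda>\<omega>. (\<zeta> x \<omega>)\<^sup>2)"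
    and mean: "\<And>x. x \<in> F \<times> {..<m} \<Longrightarrow> expectation (\<zeta> x) = 0"
    and kernel: "\<And>n. n \<in> F \<Longrightarrow> mono (\<beta> n) \<and> \<beta> n 0 = 0 \<and> (\<forall>l. \<beta> n l \<le> 1)"
  shows "expectation (\<lambda>\<omega>. MAX j\<in>{..m}. (filtered_sum F m \<beta> \<zeta> j \<omega>)\<^sup>2)
           \<le> 8 * (\<Sum>x\<in>F \<times> {..<m}. expectation (\<lambda>\<omega>. (\<zeta> x \<omega>)\<^sup>2))"
proof -
  let ?I = "F \<times> {..<m}"
  let ?V = "\<Sum>x\<in>?I. expectation (\<lambda>\<omega>. (\<zeta> x \<omega>)\<^sup>2)"
  define Q where "Q \<beta> \<omega> = (MAX j\<in>{..m}. (filtered_sum F m \<beta> \<zeta> j \<omega>)\<^sup>2)" for \<beta> \<omega>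
  have Q_int: "integrable M (Q \<beta>)" for \<beta>
    unfolding Q_def by (rule integrable_MAX_filtered_sum_square[OF ind sq])
  \<comment> \<open>Threshold kernels: apply the maximal inequality to \<open>\<zeta>\<close> and to \<open>- \<zeta>\<close>.\<close>
  have extreme: "expectation (Q (\<lambda>n l. of_bool (\<tau> n < l))) \<le> 8 * ?V" for \<tau> :: "'n \<Rightarrow> nat"
  proof -
    let ?T = "\<lambda>\<zeta> j \<omega>. \<Sum>x\<in>{x\<in>?I. (case x of (n, i) \<Rightarrow> i + \<tau> n) < j}. (\<zeta> x \<omega> :: real)"
    have T: "filtered_sum F m (\<lambda>n l. of_bool (\<tau> n < l)) \<zeta> j \<omega> = ?T \<zeta> j \<omega>" for j \<omega>
      unfolding filtered_sum_def using fin
      by (intro sum.mono_neutral_cong_right) (auto simp: less_diff_conv)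
    have ind': "indep_vars (\<lambda>_. borel) (\<lambda>x \<omega>. - \<zeta> x \<omega>) ?I"
      using indep_vars_compose2[OF ind, of "\<lambda>_. uminus" "\<lambda>_. borel"] by simp
    note P = expectation_MAX_square_le[OF _ ind sq mean, where a = "\<lambda>(n, i). i + \<tau> n" and m = m]
    note N = expectation_MAX_square_le[OF _ ind', where a = "\<lambda>(n, i). i + \<tau> n" and m = m]
    have N1: "integrable M (\<lambda>\<omega>. (MAX j\<in>{..m}. - ?T \<zeta> j \<omega>)\<^sup>2)"
      using N(1) fin sq mean by (simp add: sum_negf)
    have N2: "expectation (\<lambda>\<omega>. (MAX j\<in>{..m}. - ?T \<zeta> j \<omega>)\<^sup>2) \<le> 4 * ?V"
      using N(2) fin sq mean by (simp add: sum_negf)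
    have "expectation (Q (\<lambda>n l. of_bool (\<tau> n < l)))
        \<le> expectation (\<lambda>\<omega>. (MAX j\<in>{..m}. ?T \<zeta> j \<omega>)\<^sup>2 + (MAX j\<in>{..m}. - ?T \<zeta> j \<omega>)\<^sup>2)"
    proof (rule integral_mono[OF Q_int])
      show "integrable M (\<lambda>\<omega>. (MAX j\<in>{..m}. ?T \<zeta> j \<omega>)\<^sup>2 + (MAX j\<in>{..m}. - ?T \<zeta> j \<omega>)\<^sup>2)"
        using P(1) N1 fin by simp
    next
      fix \<omega>
      have nonneg: "0 \<le> (MAX j\<in>{..m}. f j)" if "f 0 = 0" for f :: "nat \<Rightarrow> real"
        using that Max_ge[of "f ` {..m}" "f 0"] by simp
      show "Q (\<lambda>n l. of_bool (\<tau> n < l)) \<omega>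
          \<le> (MAX j\<in>{..m}. ?T \<zeta> j \<omega>)\<^sup>2 + (MAX j\<in>{..m}. - ?T \<zeta> j \<omega>)\<^sup>2"
        unfolding Q_def T
        by (intro MAX_square_le nonneg) auto
    qed
    also have "\<dots> = expectation (\<lambda>\<omega>. (MAX j\<in>{..m}. ?T \<zeta> j \<omega>)\<^sup>2)
        + expectation (\<lambda>\<omega>. (MAX j\<in>{..m}. - ?T \<zeta> j \<omega>)\<^sup>2)"
      using P(1) N1 fin by simp
    also have "\<dots> \<le> 4 * ?V + 4 * ?V"
      using P(2) N2 fin by (intro add_mono) auto
    finally show ?thesis by simp
  qed
  \<comment> \<open>The kernels of the rows in \<open>G\<close> are replaced one row at a time; the delays \<open>\<tau>\<close> of the
    remaining rows stay arbitrary.\<close>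
  have "expectation (Q (\<lambda>n. if n \<in> G then \<beta> n else (\<lambda>l. of_bool (\<tau> n < l)))) \<le> 8 * ?V"
    if "finite G" "G \<subseteq> F" for G \<tau>
    using that
  proof (induction G arbitrary: \<tau> rule: finite_induct)
    case empty
    show ?case using extreme by simp
  next
    case (insert k G)
    have k: "mono (\<beta> k)" "\<beta> k 0 = 0" "\<And>l. \<beta> k l \<le> 1" using kernel insert.prems by auto
    \<comment> \<open>The weight of the threshold \<open>m\<close>, which is invisible for \<open>l \<le> m\<close>, completes the total mass to 1, so
      that the other rows are reproduced exactly.\<close>
    define w where "w q = (if q < m then \<beta> k (Suc q) - \<beta> k q else 1 - \<beta> k m)" for q
    have w: "0 \<le> w q" for q using k by (simp add: w_def mono_def)
    have "(\<Sum>q\<le>m. w q) = w m + (\<Sum>q<m. w q)"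
      by (simp flip: lessThan_Suc_atMost)
    also have "(\<Sum>q<m. w q) = \<beta> k m"
      using k(2) sum_lessThan_telescope[of "\<beta> k" m] by (simp add: w_def)
    finally have w1: "(\<Sum>q\<le>m. w q) = 1" by (simp add: w_def)
    define B where "B \<tau> = (\<lambda>n. if n \<in> G then \<beta> n else (\<lambda>l. of_bool (\<tau> n < l)))" for \<tau>
    define B' where "B' = (\<lambda>n. if n \<in> insert k G then \<beta> n else (\<lambda>l. of_bool (\<tau> n < l)))"
    have kernels: "B' n l = (\<Sum>q\<le>m. w q * B (\<tau>(k := q)) n l)" if "l \<le> m" for n l
    proof (cases "n = k")
      case True
      have "(\<Sum>q\<le>m. w q * B (\<tau>(k := q)) n l) = (\<Sum>q<m. w q * of_bool (q < l))"
        using True insert.hyps that by (simp add: B_def flip: lessThan_Suc_atMost)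
      also have "\<dots> = \<beta> k l"
        using monotone_eq_sum_indicators[of "\<beta> k" l m] k(2) that by (simp add: w_def)
      finally show ?thesis using True by (simp add: B'_def)
    next
      case False
      then have "(\<Sum>q\<le>m. w q * B (\<tau>(k := q)) n l) = (\<Sum>q\<le>m. w q) * B' n l"
        unfolding sum_distrib_right by (intro sum.cong refl) (auto simp: B_def B'_def)
      then show ?thesis by (simp add: w1)
    qed
    have lin: "filtered_sum F m B' \<zeta> j \<omega>
        = (\<Sum>q\<le>m. w q * filtered_sum F m (B (\<tau>(k := q))) \<zeta> j \<omega>)" if "j \<le> m" for j \<omega>
    proof -
      have "filtered_sum F m B' \<zeta> j \<omega>
          = (\<Sum>(n, i)\<in>?I. \<Sum>q\<le>m. w q * (B (\<tau>(k := q)) n (j - i) * \<zeta> (n, i) \<omega>))"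
        unfolding filtered_sum_def using that
        by (intro sum.cong refl) (auto simp: kernels sum_distrib_right mult.assoc)
      also have "\<dots> = (\<Sum>q\<le>m. \<Sum>(n, i)\<in>?I. w q * (B (\<tau>(k := q)) n (j - i) * \<zeta> (n, i) \<omega>))"
        unfolding case_prod_unfold by (rule sum.swap)
      finally show ?thesis
        by (simp add: filtered_sum_def sum_distrib_left case_prod_unfold)
    qed
    have "Q B' \<omega> \<le> (\<Sum>q\<le>m. w q * Q (B (\<tau>(k := q))) \<omega>)" for \<omega>
      unfolding Q_def[of B']
    proof (rule Max.boundedI)
      fix x assume "x \<in> (\<lambda>j. (filtered_sum F m B' \<zeta> j \<omega>)\<^sup>2) ` {..m}"
      then obtain j where j: "j \<le> m" "x = (filtered_sum F m B' \<zeta> j \<omega>)\<^sup>2" by auto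
      have "x \<le> (\<Sum>q\<le>m. w q * (filtered_sum F m (B (\<tau>(k := q))) \<zeta> j \<omega>)\<^sup>2)"
        unfolding j(2) lin[OF j(1)] by (rule convex_sum_square_le) (use w w1 in auto)
      also have "\<dots> \<le> (\<Sum>q\<le>m. w q * Q (B (\<tau>(k := q))) \<omega>)"
        unfolding Q_def using j(1) by (intro sum_mono mult_left_mono w Max_ge) auto
      finally show "x \<le> (\<Sum>q\<le>m. w q * Q (B (\<tau>(k := q))) \<omega>)" .
    qed auto
    then have "expectation (Q B') \<le> expectation (\<lambda>\<omega>. \<Sum>q\<le>m. w q * Q (B (\<tau>(k := q))) \<omega>)"
      using Q_int by (intro integral_mono) auto
    also have "\<dots> = (\<Sum>q\<le>m. w q * expectation (Q (B (\<tau>(k := q)))))"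
      using Q_int by simp
    also have "\<dots> \<le> (\<Sum>q\<le>m. w q * (8 * ?V))"
      using insert.IH insert.prems w by (intro sum_mono mult_left_mono) (auto simp: B_def)
    also have "\<dots> = 8 * ?V" using w1 by (simp flip: sum_distrib_right)
    finally show ?case by (simp add: B'_def)
  qed
  note bound = this[OF fin order_refl, of "\<lambda>_. 0"]
  have fs: "filtered_sum F m (\<lambda>n. if n \<in> F then \<beta> n else (\<lambda>l. of_bool (0 < l))) \<zeta>
      = filtered_sum F m \<beta> \<zeta>"
    by (intro ext) (auto simp: filtered_sum_def intro!: sum.cong)
  show "expectation (\<lambda>\<omega>. MAX j\<in>{..m}. (filtered_sum F m \<beta> \<zeta> j \<omega>)\<^sup>2) \<le> 8 * ?V"
    using bound unfolding Q_def fs .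
qed

end

lemma filtered_sum_diff:
  "filtered_sum F m (\<lambda>n l. \<beta> n l - \<beta>' n l) \<zeta> j \<omega>
     = filtered_sum F m \<beta> \<zeta> j \<omega> - filtered_sum F m \<beta>' \<zeta> j \<omega>"
  by (simp add: filtered_sum_def left_diff_distrib sum_subtractf case_prod_unfold)

context prob_space
begin

text \<open>A kernel that decreases on the positive lags is the unit step minus a nondecreasing kernel, and the
  preceding inequality applies to both.\<close>

lemma filtered_sum_decreasing_MAX_square_le:
  fixes \<zeta> :: "'n \<times> nat \<Rightarrow> 'a \<Rightarrow> real"
  assumes fin: "finite F" and ind: "indep_vars (\<lambda>_. borel) \<zeta> (F \<times> {..<m})"
    and sq: "\<And>x. x \<in> F \<times> {..<m} \<Longrightarrow> integrable M (\<lambda>\<omega>. (\<zeta> x \<omega>)\<^sup>2)"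
    and mean: "\<And>x. x \<in> F \<times> {..<m} \<Longrightarrow> expectation (\<zeta> x) = 0"
    and kernel: "\<And>n. n \<in> F \<Longrightarrow> antimono_on {0<..} (\<rho> n) \<and> \<rho> n 0 = 0 \<and> (\<forall>l. 0 \<le> \<rho> n l \<and> \<rho> n l \<le> 1)"
  shows "expectation (\<lambda>\<omega>. MAX j\<in>{..m}. (filtered_sum F m \<rho> \<zeta> j \<omega>)\<^sup>2)
           \<le> 32 * (\<Sum>x\<in>F \<times> {..<m}. expectation (\<lambda>\<omega>. (\<zeta> x \<omega>)\<^sup>2))"
proof -
  let ?V = "\<Sum>x\<in>F \<times> {..<m}. expectation (\<lambda>\<omega>. (\<zeta> x \<omega>)\<^sup>2)"
  define h :: "'n \<Rightarrow> nat \<Rightarrow> real" where "h n l = of_bool (0 < l)" for n l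
  define \<beta> where "\<beta> n l = h n l - \<rho> n l" for n l
  let ?Q = "\<lambda>\<beta> \<omega>. MAX j\<in>{..m}. (filtered_sum F m \<beta> \<zeta> j \<omega>)\<^sup>2"
  have Q_int: "integrable M (?Q \<beta>)" for \<beta>
    by (rule integrable_MAX_filtered_sum_square[OF ind sq])
  have h_mono: "mono (h n) \<and> h n 0 = 0 \<and> (\<forall>l. h n l \<le> 1)" for n
    by (auto simp: h_def mono_def)
  have \<beta>_mono: "mono (\<beta> n) \<and> \<beta> n 0 = 0 \<and> (\<forall>l. \<beta> n l \<le> 1)" if "n \<in> F" for n
  proof -
    have "\<beta> n k \<le> \<beta> n l" if "k \<le> l" for k l
      using kernel[OF \<open>n \<in> F\<close>] that
      by (cases "k = 0") (auto simp: \<beta>_def h_def monotone_on_def)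
    then show ?thesis using kernel[OF that] by (auto simp: \<beta>_def h_def mono_def)
  qed
  have split: "?Q \<rho> \<omega> \<le> 2 * ?Q h \<omega> + 2 * ?Q \<beta> \<omega>" for \<omega>
  proof (rule Max.boundedI)
    fix x assume "x \<in> (\<lambda>j. (filtered_sum F m \<rho> \<zeta> j \<omega>)\<^sup>2) ` {..m}"
    then obtain j where j: "j \<le> m" "x = (filtered_sum F m \<rho> \<zeta> j \<omega>)\<^sup>2" by auto
    let ?u = "filtered_sum F m h \<zeta> j \<omega>" and ?v = "filtered_sum F m \<beta> \<zeta> j \<omega>"
    have "filtered_sum F m \<rho> \<zeta> j \<omega> = ?u - ?v"
      using filtered_sum_diff[of F m h \<beta>] by (simp add: \<beta>_def)
    moreover have "0 \<le> (?u + ?v)\<^sup>2" by simp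
    ultimately have "x \<le> 2 * ?u\<^sup>2 + 2 * ?v\<^sup>2"
      unfolding j(2) by (simp only: power2_diff power2_sum)
    also have "\<dots> \<le> 2 * ?Q h \<omega> + 2 * ?Q \<beta> \<omega>"
      using j(1) by (intro add_mono mult_left_mono Max_ge) auto
    finally show "x \<le> 2 * ?Q h \<omega> + 2 * ?Q \<beta> \<omega>" .
  qed auto
  have "expectation (?Q \<rho>) \<le> expectation (\<lambda>\<omega>. 2 * ?Q h \<omega> + 2 * ?Q \<beta> \<omega>)"
    using split Q_int by (intro integral_mono) auto
  also have "\<dots> = 2 * expectation (?Q h) + 2 * expectation (?Q \<beta>)"
    using Q_int by simp
  also have "\<dots> \<le> 2 * (8 * ?V) + 2 * (8 * ?V)"
    using filtered_sum_MAX_square_le[OF fin ind sq mean, of h] h_mono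
      filtered_sum_MAX_square_le[OF fin ind sq mean, of \<beta>] \<beta>_mono
    by (intro add_mono mult_left_mono) auto
  finally show "expectation (?Q \<rho>) \<le> 32 * ?V" by simp
qed

section \<open>Truncation of symmetric summands\<close>

lemma symmetric_truncation:
  fixes X :: "'a \<Rightarrow> real"
  assumes [measurable]: "X \<in> borel_measurable M"
    and sym: "distr M borel (\<lambda>\<omega>. - X \<omega>) = distr M borel X"
  defines "T \<equiv> \<lambda>\<omega>. X \<omega> * of_bool (\<bar>X \<omega>\<bar> \<le> 1)"
  shows "T \<in> borel_measurable M"
    and "integrable M (\<lambda>\<omega>. (T \<omega>)\<^sup>2)"
    and "expectation T = 0"
    and "expectation (\<lambda>\<omega>. (T \<omega>)\<^sup>2) \<le> expectation (\<lambda>\<omega>. min 1 ((X \<omega>)\<^sup>2))"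
    and "prob {\<omega>\<in>space M. T \<omega> \<noteq> X \<omega>} \<le> expectation (\<lambda>\<omega>. min 1 ((X \<omega>)\<^sup>2))"
proof -
  show meas[measurable]: "T \<in> borel_measurable M"
    unfolding T_def by (intro borel_measurable_times) (auto simp: of_bool_def)
  have min_int: "integrable M (\<lambda>\<omega>. min 1 ((X \<omega>)\<^sup>2))"
    by (rule integrable_const_bound[of _ 1]) auto
  have le: "(T \<omega>)\<^sup>2 \<le> min 1 ((X \<omega>)\<^sup>2)" for \<omega>
    by (auto simp: T_def abs_square_le_1)
  show sq: "integrable M (\<lambda>\<omega>. (T \<omega>)\<^sup>2)"
    by (rule Bochner_Integration.integrable_bound[OF min_int]) (use le in auto)
  show "expectation (\<lambda>\<omega>. (T \<omega>)\<^sup>2) \<le> expectation (\<lambda>\<omega>. min 1 ((X \<omega>)\<^sup>2))"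
    by (rule integral_mono[OF sq min_int le])
  define t :: "real \<Rightarrow> real" where "t x = x * of_bool (\<bar>x\<bar> \<le> 1)" for x
  have [measurable]: "t \<in> borel_measurable borel"
    unfolding t_def of_bool_def by measurable
  have "expectation T = integral\<^sup>L (distr M borel X) t"
    by (subst integral_distr) (auto simp: T_def t_def)
  also have "\<dots> = integral\<^sup>L (distr M borel (\<lambda>\<omega>. - X \<omega>)) t"
    by (simp add: sym)
  also have "\<dots> = - expectation T"
    by (subst integral_distr) (auto simp: T_def t_def)
  finally show "expectation T = 0" by simp
  have "prob {\<omega>\<in>space M. T \<omega> \<noteq> X \<omega>} \<le> prob {\<omega>\<in>space M. 1 \<le> min 1 ((X \<omega>)\<^sup>2)}"
  proof (rule finite_measure_mono)
    show "{\<omega>\<in>space M. T \<omega> \<noteq> X \<omega>} \<subseteq> {\<omega>\<in>space M. 1 \<le> min 1 ((X \<omega>)\<^sup>2)}"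
      by (auto simp: T_def simp flip: abs_square_le_1)
  qed measurable
  also have "\<dots> \<le> expectation (\<lambda>\<omega>. min 1 ((X \<omega>)\<^sup>2)) / 1"
    by (rule integral_Markov_inequality_measure[OF min_int, of "{}"]) auto
  finally show "prob {\<omega>\<in>space M. T \<omega> \<noteq> X \<omega>} \<le> expectation (\<lambda>\<omega>. min 1 ((X \<omega>)\<^sup>2))" by simp
qed

text \<open>Off the event that some \<open>\<xi> x\<close> exceeds 1 in absolute value the sums agree
  with those of the truncated variables, which are still independent and, by symmetry, centred; for
  these the second-moment inequality and Markov's inequality apply.\<close>

lemma prob_filtered_sum_decreasing_le:
  fixes \<xi> :: "'n \<times> nat \<Rightarrow> 'a \<Rightarrow> real"
  assumes fin: "finite F" and ind: "indep_vars (\<lambda>_. borel) \<xi> (F \<times> {..<m})"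
    and sym: "\<And>x. x \<in> F \<times> {..<m} \<Longrightarrow> distr M borel (\<lambda>\<omega>. - \<xi> x \<omega>) = distr M borel (\<xi> x)"
    and kernel: "\<And>n. n \<in> F \<Longrightarrow> antimono_on {0<..} (\<rho> n) \<and> \<rho> n 0 = 0 \<and> (\<forall>l. 0 \<le> \<rho> n l \<and> \<rho> n l \<le> 1)"
    and \<eta>: "0 < \<eta>"
  shows "prob {\<omega>\<in>space M. \<exists>j\<le>m. \<eta> < \<bar>filtered_sum F m \<rho> \<xi> j \<omega>\<bar>}
           \<le> (1 + 32 / \<eta>\<^sup>2) * (\<Sum>x\<in>F \<times> {..<m}. expectation (\<lambda>\<omega>. min 1 ((\<xi> x \<omega>)\<^sup>2)))"
proof -
  let ?I = "F \<times> {..<m}"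
  let ?v = "\<lambda>x. expectation (\<lambda>\<omega>. min 1 ((\<xi> x \<omega>)\<^sup>2))"
  define \<zeta> where "\<zeta> x \<omega> = \<xi> x \<omega> * of_bool (\<bar>\<xi> x \<omega>\<bar> \<le> 1)" for x \<omega>
  have meas_\<xi>[measurable]: "\<xi> x \<in> borel_measurable M" if "x \<in> ?I" for x
    using ind that by (auto simp: indep_vars_def)
  note tr = symmetric_truncation[OF meas_\<xi> sym, folded \<zeta>_def]
  note [measurable] = tr(1)
  have ind': "indep_vars (\<lambda>_. borel) \<zeta> ?I"
    unfolding \<zeta>_def
    by (rule indep_vars_compose2[OF ind, where Y = "\<lambda>_ x. x * of_bool (\<bar>x\<bar> \<le> 1)"])
       (auto simp: of_bool_def)
  have meas_fs[measurable]: "filtered_sum F m \<rho> Z j \<in> borel_measurable M"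
    if "\<And>x. x \<in> ?I \<Longrightarrow> Z x \<in> borel_measurable M" for Z j
    unfolding filtered_sum_def case_prod_unfold using that by measurable
  note MAX = filtered_sum_decreasing_MAX_square_le[OF fin ind' tr(2) tr(3) kernel, simplified]
  define Q where "Q \<omega> = (MAX j\<in>{..m}. (filtered_sum F m \<rho> \<zeta> j \<omega>)\<^sup>2)" for \<omega>
  have Q_int: "integrable M Q" 
    unfolding Q_def by (rule integrable_MAX_filtered_sum_square[OF ind' tr(2)])
  have EQ: "expectation Q \<le> 32 * (\<Sum>x\<in>?I. ?v x)"
  proof -
    have "expectation Q \<le> 32 * (\<Sum>x\<in>?I. expectation (\<lambda>\<omega>. (\<zeta> x \<omega>)\<^sup>2))"
      using MAX by (simp add: Q_def[abs_def])
    also have "\<dots> \<le> 32 * (\<Sum>x\<in>?I. ?v x)"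
      using tr(4) by (intro mult_left_mono sum_mono) auto
    finally show ?thesis .
  qed
  have Q_meas[measurable]: "Q \<in> borel_measurable M" using Q_int by auto
  have cut_sets: "{\<omega>\<in>space M. \<zeta> x \<omega> \<noteq> \<xi> x \<omega>} \<in> events" if "x \<in> ?I" for x
  proof -
    have [measurable]: "\<zeta> x \<in> borel_measurable M" "\<xi> x \<in> borel_measurable M"
      using tr(1) meas_\<xi> that by auto
    show ?thesis by measurable
  qed
  have Q_sets: "{\<omega>\<in>space M. \<eta>\<^sup>2 \<le> Q \<omega>} \<in> events" by measurable
  have "{\<omega>\<in>space M. \<exists>j\<le>m. \<eta> < \<bar>filtered_sum F m \<rho> \<xi> j \<omega>\<bar>}
      \<subseteq> {\<omega>\<in>space M. \<eta>\<^sup>2 \<le> Q \<omega>} \<union> (\<Union>x\<in>?I. {\<omega>\<in>space M. \<zeta> x \<omega> \<noteq> \<xi> x \<omega>})"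
  proof safe
    fix \<omega> j assume \<omega>: "\<omega> \<in> space M" "j \<le> m" "\<eta> < \<bar>filtered_sum F m \<rho> \<xi> j \<omega>\<bar>"
      "\<omega> \<notin> (\<Union>x\<in>?I. {\<omega>\<in>space M. \<zeta> x \<omega> \<noteq> \<xi> x \<omega>})"
    then have "\<zeta> x \<omega> = \<xi> x \<omega>" if "x \<in> ?I" for x using that by blast
    then have "filtered_sum F m \<rho> \<zeta> j \<omega> = filtered_sum F m \<rho> \<xi> j \<omega>"
      by (auto simp: filtered_sum_def intro!: sum.cong)
    then have "\<eta>\<^sup>2 \<le> (filtered_sum F m \<rho> \<zeta> j \<omega>)\<^sup>2"
      using \<omega>(3) \<eta> by (simp add: abs_le_square_iff[symmetric])
    also have "\<dots> \<le> Q \<omega>" using \<omega>(2) by (auto simp: Q_def intro!: Max_ge)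
    finally show "\<eta>\<^sup>2 \<le> Q \<omega>" .
  qed
  then have "prob {\<omega>\<in>space M. \<exists>j\<le>m. \<eta> < \<bar>filtered_sum F m \<rho> \<xi> j \<omega>\<bar>}
      \<le> prob ({\<omega>\<in>space M. \<eta>\<^sup>2 \<le> Q \<omega>} \<union> (\<Union>x\<in>?I. {\<omega>\<in>space M. \<zeta> x \<omega> \<noteq> \<xi> x \<omega>}))"
    using fin cut_sets Q_sets by (intro finite_measure_mono sets.Un sets.finite_UN) auto
  also have "\<dots> \<le> prob {\<omega>\<in>space M. \<eta>\<^sup>2 \<le> Q \<omega>} + prob (\<Union>x\<in>?I. {\<omega>\<in>space M. \<zeta> x \<omega> \<noteq> \<xi> x \<omega>})"
    using fin cut_sets Q_sets by (intro measure_Un_le sets.finite_UN) auto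
  also have "prob (\<Union>x\<in>?I. {\<omega>\<in>space M. \<zeta> x \<omega> \<noteq> \<xi> x \<omega>})
      \<le> (\<Sum>x\<in>?I. prob {\<omega>\<in>space M. \<zeta> x \<omega> \<noteq> \<xi> x \<omega>})"
    using fin cut_sets by (intro finite_measure_subadditive_finite) auto
  also have "\<dots> \<le> (\<Sum>x\<in>?I. ?v x)"
    using tr(5) by (intro sum_mono)
  also have "prob {\<omega>\<in>space M. \<eta>\<^sup>2 \<le> Q \<omega>} \<le> expectation Q / \<eta>\<^sup>2"
  proof (rule integral_Markov_inequality_measure[OF Q_int, of "{}"])
    have "0 \<le> Q \<omega>" for \<omega>
    proof -
      have "(filtered_sum F m \<rho> \<zeta> 0 \<omega>)\<^sup>2 \<le> Q \<omega>" by (auto simp: Q_def intro!: Max_ge)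
      then show ?thesis using order_trans zero_le_power2 by blast
    qed
    then show "AE \<omega> in M. 0 \<le> Q \<omega>" by simp
  qed (use \<eta> in auto)
  also have "expectation Q / \<eta>\<^sup>2 \<le> 32 * (\<Sum>x\<in>?I. ?v x) / \<eta>\<^sup>2"
    by (intro divide_right_mono EQ) simp
  finally show ?thesis by (simp add: algebra_simps)
qed

end

section \<open>Truncated moments from the characteristic function\<close>

lemma min_one_square_le: "min 1 (x\<^sup>2) \<le> 3 * (1 - exp (- (x\<^sup>2) / 2))" for x :: real
proof -
  define u where "u = x\<^sup>2 / 2"
  have u: "0 \<le> u" by (simp add: u_def)
  have "exp (- u) \<le> 1 / (1 + u)"
    using exp_ge_add_one_self[of u] u by (simp add: exp_minus field_simps)
  then have "u / (1 + u) \<le> 1 - exp (- u)" using u by (simp add: field_simps)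
  moreover have "min 1 (2 * u) \<le> 3 * (u / (1 + u))"
  proof (cases "2 * u \<le> 1")
    case True
    then have "2 * u * (1 + u) \<le> 2 * u * (3 / 2)" using u by (intro mult_left_mono) auto
    then show ?thesis using u True by (simp add: field_simps)
  qed (use u in \<open>simp add: field_simps\<close>)
  ultimately show ?thesis by (simp add: u_def)
qed

lemma one_minus_exp_le_min: "1 - exp (- (x\<^sup>2) / 2) \<le> min 1 (x\<^sup>2)" for x :: real
proof -
  have "1 - exp (- (x\<^sup>2) / 2) \<le> x\<^sup>2 / 2"
    using exp_ge_add_one_self[of "- (x\<^sup>2) / 2"] by simp
  also have "\<dots> \<le> x\<^sup>2" by simp
  finally show ?thesis by simp
qed

text \<open>The Gaussian average of \<open>1 - cos (g x)\<close> is comparable to \<open>min 1 (x\<^sup>2)\<close> from both sides, by the two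
  preceding estimates. Unlike \<open>1 - cos (g x)\<close> for a fixed frequency, it does not vanish at nonzero
  \<open>x\<close>.\<close>

lemma nn_integral_std_normal_one_minus_cos:
  "(\<integral>\<^sup>+g. ennreal (1 - cos (g * x)) \<partial>std_normal_distribution) = ennreal (1 - exp (- (x\<^sup>2) / 2))"
proof -
  interpret N: real_distribution std_normal_distribution by (rule real_dist_normal_dist)
  have int: "integrable std_normal_distribution (\<lambda>g. cos (g * x))"
    by (rule N.integrable_const_bound[of _ 1]) auto
  have "Re (char std_normal_distribution x) = (\<integral>g. Re (iexp (x * g)) \<partial>std_normal_distribution)"
    unfolding char_def by (rule integral_Re[symmetric]) (rule N.integrable_iexp, simp_all)
  then have "(\<integral>g. cos (g * x) \<partial>std_normal_distribution) = exp (- (x\<^sup>2) / 2)"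
    by (simp add: char_std_normal_distribution Re_exp mult.commute)
  then have "(\<integral>g. 1 - cos (g * x) \<partial>std_normal_distribution) = 1 - exp (- (x\<^sup>2) / 2)"
    using int N.prob_space by simp
  moreover have "(\<integral>\<^sup>+g. ennreal (1 - cos (g * x)) \<partial>std_normal_distribution)
      = ennreal (\<integral>g. 1 - cos (g * x) \<partial>std_normal_distribution)"
    using int by (intro nn_integral_eq_integral) auto
  ultimately show ?thesis by simp
qed

lemma ennreal_integral_le_nn_integral:
  fixes f :: "'x \<Rightarrow> real"
  assumes "\<And>x. 0 \<le> f x"
  shows "ennreal (\<integral>x. f x \<partial>N) \<le> (\<integral>\<^sup>+x. ennreal (f x) \<partial>N)"
proof (cases "integrable N f")
  case True
  then show ?thesis using assms by (subst nn_integral_eq_integral) auto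
qed (simp add: not_integrable_integral_eq)

text \<open>With \<open>\<psi> \<theta> = \<integral> 1 - cos (\<theta> y) d\<nu>\<close> the characteristic function satisfies \<open>1 - exp (- h \<psi>) \<le> h \<psi>\<close>. Averaging
  this inequality over a Gaussian frequency and exchanging the integrals turns both sides into
  truncated second moments, of \<open>a X\<close> on the left and of \<open>\<nu>\<close> on the right.\<close>

lemma (in prob_space) nn_integral_min_square_le:
  fixes X :: "'a \<Rightarrow> real" and a h :: real
  assumes [measurable]: "X \<in> borel_measurable M"
    and \<nu>: "sigma_finite_measure \<nu>" and sets[measurable_cong]: "sets \<nu> = sets borel"
    and h: "0 \<le> h"
    and char: "\<And>\<theta>. char (distr M borel X) \<theta> = complex_of_real (exp (- h * (\<integral>y. 1 - cos (\<theta> * y) \<partial>\<nu>)))"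
  shows "(\<integral>\<^sup>+\<omega>. ennreal (min 1 ((a * X \<omega>)\<^sup>2)) \<partial>M)
      \<le> ennreal (3 * h) * (\<integral>\<^sup>+y. ennreal (min 1 ((a * y)\<^sup>2)) \<partial>\<nu>)"
proof -
  let ?G = std_normal_distribution
  interpret N: real_distribution ?G by (rule real_dist_normal_dist)
  interpret \<nu>: sigma_finite_measure \<nu> by (rule \<nu>)
  interpret MG: pair_sigma_finite M ?G ..
  interpret \<nu>G: pair_sigma_finite \<nu> ?G ..
  let ?\<psi> = "\<lambda>\<theta>. \<integral>y. 1 - cos (\<theta> * y) \<partial>\<nu>"
  have cosX: "(\<integral>\<^sup>+\<omega>. ennreal (1 - cos (\<theta> * X \<omega>)) \<partial>M) = ennreal (1 - exp (- h * ?\<psi> \<theta>))" for \<theta>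
  proof -
    have int: "integrable M (\<lambda>\<omega>. cos (\<theta> * X \<omega>))"
      by (rule integrable_const_bound[of _ 1]) auto
    have "char (distr M borel X) \<theta> = (CLINT \<omega>|M. iexp (\<theta> * X \<omega>))"
      unfolding char_def by (subst integral_distr) auto
    also have "Re \<dots> = (\<integral>\<omega>. Re (iexp (\<theta> * X \<omega>)) \<partial>M)"
      by (rule integral_Re[symmetric]) (rule integrable_iexp, simp_all)
    finally have "(\<integral>\<omega>. cos (\<theta> * X \<omega>) \<partial>M) = exp (- h * ?\<psi> \<theta>)"
      by (simp add: char Re_exp)
    then have "(\<integral>\<omega>. 1 - cos (\<theta> * X \<omega>) \<partial>M) = 1 - exp (- h * ?\<psi> \<theta>)"
      using int prob_space by simp
    moreover have "(\<integral>\<^sup>+\<omega>. ennreal (1 - cos (\<theta> * X \<omega>)) \<partial>M) = ennreal (\<integral>\<omega>. 1 - cos (\<theta> * X \<omega>) \<partial>M)"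
      using int by (intro nn_integral_eq_integral) auto
    ultimately show ?thesis by simp
  qed
  have "(\<integral>\<^sup>+\<omega>. ennreal (min 1 ((a * X \<omega>)\<^sup>2)) \<partial>M)
      \<le> (\<integral>\<^sup>+\<omega>. ennreal 3 * ennreal (1 - exp (- ((a * X \<omega>)\<^sup>2) / 2)) \<partial>M)"
  proof (rule nn_integral_mono)
    fix \<omega>
    have "ennreal (min 1 ((a * X \<omega>)\<^sup>2)) \<le> ennreal (3 * (1 - exp (- ((a * X \<omega>)\<^sup>2) / 2)))"
      by (intro ennreal_leI min_one_square_le)
    then show "ennreal (min 1 ((a * X \<omega>)\<^sup>2)) \<le> ennreal 3 * ennreal (1 - exp (- ((a * X \<omega>)\<^sup>2) / 2))"
      by (simp only: ennreal_mult'[of 3])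
  qed
  also have "\<dots> = ennreal 3 * (\<integral>\<^sup>+\<omega>. ennreal (1 - exp (- ((a * X \<omega>)\<^sup>2) / 2)) \<partial>M)"
    by (intro nn_integral_cmult) measurable
  also have "(\<integral>\<^sup>+\<omega>. ennreal (1 - exp (- ((a * X \<omega>)\<^sup>2) / 2)) \<partial>M)
      = (\<integral>\<^sup>+\<omega>. \<integral>\<^sup>+g. ennreal (1 - cos (g * (a * X \<omega>))) \<partial>?G \<partial>M)"
    by (subst nn_integral_std_normal_one_minus_cos) simp
  also have "\<dots> = (\<integral>\<^sup>+g. \<integral>\<^sup>+\<omega>. ennreal (1 - cos (g * (a * X \<omega>))) \<partial>M \<partial>?G)"
    by (rule MG.Fubini'[symmetric]) measurable
  also have "\<dots> = (\<integral>\<^sup>+g. ennreal (1 - exp (- h * ?\<psi> (g * a))) \<partial>?G)"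
    by (simp only: mult.assoc[symmetric] cosX)
  also have "\<dots> \<le> (\<integral>\<^sup>+g. ennreal h * (\<integral>\<^sup>+y. ennreal (1 - cos (g * a * y)) \<partial>\<nu>) \<partial>?G)"
  proof (rule nn_integral_mono)
    fix g
    have "ennreal (1 - exp (- h * ?\<psi> (g * a))) \<le> ennreal (h * ?\<psi> (g * a))"
      using exp_ge_add_one_self[of "- h * ?\<psi> (g * a)"] by (intro ennreal_leI) simp
    also have "\<dots> = ennreal h * ennreal (?\<psi> (g * a))"
      using h by (rule ennreal_mult')
    also have "\<dots> \<le> ennreal h * (\<integral>\<^sup>+y. ennreal (1 - cos (g * a * y)) \<partial>\<nu>)"
      by (intro mult_left_mono ennreal_integral_le_nn_integral) auto
    finally show "ennreal (1 - exp (- h * ?\<psi> (g * a)))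
        \<le> ennreal h * (\<integral>\<^sup>+y. ennreal (1 - cos (g * a * y)) \<partial>\<nu>)" .
  qed
  also have "\<dots> = ennreal h * (\<integral>\<^sup>+g. \<integral>\<^sup>+y. ennreal (1 - cos (g * a * y)) \<partial>\<nu> \<partial>?G)"
    by (intro nn_integral_cmult) measurable
  also have "(\<integral>\<^sup>+g. \<integral>\<^sup>+y. ennreal (1 - cos (g * a * y)) \<partial>\<nu> \<partial>?G)
      = (\<integral>\<^sup>+y. \<integral>\<^sup>+g. ennreal (1 - cos (g * (a * y))) \<partial>?G \<partial>\<nu>)"
    by (subst \<nu>G.Fubini') (measurable, simp only: mult.assoc)
  also have "\<dots> = (\<integral>\<^sup>+y. ennreal (1 - exp (- ((a * y)\<^sup>2) / 2)) \<partial>\<nu>)"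
    by (subst nn_integral_std_normal_one_minus_cos) simp
  also have "\<dots> \<le> (\<integral>\<^sup>+y. ennreal (min 1 ((a * y)\<^sup>2)) \<partial>\<nu>)"
    by (intro nn_integral_mono ennreal_leI one_minus_exp_le_min)
  finally show ?thesis
    using h by (simp add: ennreal_mult mult.assoc mult_left_mono)
qed

text \<open>Needed for Tonelli's theorem: Levy measures may be infinite near the origin, but \<open>min (y\<^sup>2) 1\<close> is
  integrable and vanishes only at \<open>0\<close>, a null set.\<close>

lemma symmetric_levy_measure_sigma_finite:
  assumes "symmetric_levy_measure \<nu>"
  shows "sigma_finite_measure \<nu>"
proof
  have sets[measurable_cong]: "sets \<nu> = sets borel" and zero: "emeasure \<nu> {0} = 0"
    and fin: "(\<integral>\<^sup>+ y. ennreal (min (y\<^sup>2) 1) \<partial>\<nu>) < \<infinity>"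
    using assms by (auto simp: symmetric_levy_measure_def)
  have space: "space \<nu> = UNIV" using sets_eq_imp_space_eq[OF sets] by simp
  let ?A = "\<lambda>k::nat. {y::real. 1 / Suc k \<le> min (y\<^sup>2) 1}"
  have A: "?A k \<in> sets \<nu>" for k
    unfolding sets by measurable
  have "emeasure \<nu> (?A k) \<noteq> \<infinity>" for k
  proof -
    have "emeasure \<nu> (?A k) = emeasure \<nu> {y\<in>space \<nu>. 1 \<le> ennreal (Suc k) * ennreal (min (y\<^sup>2) 1)}"
    proof (rule arg_cong[where f = "emeasure \<nu>"], rule Collect_cong)
      fix y :: real
      have "ennreal (Suc k) * ennreal (min (y\<^sup>2) 1) = ennreal (min (y\<^sup>2) 1 * Suc k)"
        by (subst ennreal_mult[symmetric]) (auto simp: mult.commute)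
      then show "1 / Suc k \<le> min (y\<^sup>2) 1
          \<longleftrightarrow> y \<in> space \<nu> \<and> 1 \<le> ennreal (Suc k) * ennreal (min (y\<^sup>2) 1)"
        by (simp only: space ennreal_ge_1 pos_divide_le_eq of_nat_0_less_iff zero_less_Suc UNIV_I simp_thms)
    qed
    also have "\<dots> \<le> ennreal (Suc k) * (\<integral>\<^sup>+ y. ennreal (min (y\<^sup>2) 1) * indicator (space \<nu>) y \<partial>\<nu>)"
      by (rule nn_integral_Markov_inequality) measurable
    also have "\<dots> < \<infinity>"
      using fin by (simp add: space ennreal_mult_less_top)
    finally show ?thesis by simp
  qed
  moreover have "(\<Union>k. ?A k) \<union> {0} = space \<nu>"
  proof -
    have "y \<in> (\<Union>k. ?A k)" if "y \<noteq> 0" for y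
    proof -
      have "0 < min (y\<^sup>2) 1" using that by simp
      then obtain k :: nat where "1 / Suc k < min (y\<^sup>2) 1"
        using nat_approx_posE by blast
      then show ?thesis by (auto intro: less_imp_le)
    qed
    then show ?thesis by (auto simp: space)
  qed
  ultimately show "\<exists>A. countable A \<and> A \<subseteq> sets \<nu> \<and> \<Union>A = space \<nu> \<and> (\<forall>a\<in>A. emeasure \<nu> a \<noteq> \<infinity>)"
    using A zero sets by (intro exI[of _ "insert {0} (range ?A)"]) auto
qed

text \<open>The right-hand side is what the hypotheses on the Levy measures control. The factor 2 accounts for
  the jumps below \<open>- \<epsilon> / b\<close>, which are as frequent as those above \<open>\<epsilon> / b\<close> by symmetry.\<close>

lemma nn_integral_min_square_le_split:
  assumes \<nu>: "symmetric_levy_measure \<nu>" and \<epsilon>: "0 < \<epsilon>" and b: "0 < b" "\<bar>a\<bar> = b"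
  shows "(\<integral>\<^sup>+y. ennreal (min 1 ((a * y)\<^sup>2)) \<partial>\<nu>)
    \<le> ennreal (b\<^sup>2) * (\<integral>\<^sup>+ y \<in> {y. b * \<bar>y\<bar> \<le> \<epsilon>}. ennreal (\<bar>y\<bar>\<^sup>2) \<partial>\<nu>)
      + 2 * emeasure \<nu> {\<epsilon> / b ..}"
proof -
  have sets[measurable_cong]: "sets \<nu> = sets borel" and sym: "distr \<nu> borel uminus = \<nu>"
    using \<nu> by (auto simp: symmetric_levy_measure_def)
  have space: "space \<nu> = UNIV" using sets_eq_imp_space_eq[OF sets] by simp
  let ?S = "{y. b * \<bar>y\<bar> \<le> \<epsilon>}" and ?U = "{\<epsilon> / b ..}" and ?D = "{y. \<epsilon> / b \<le> - y}"
  have "?D \<in> sets borel" by measurable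
  then have D[measurable]: "?D \<in> sets \<nu>" by (simp add: sets)
  have U[measurable]: "?U \<in> sets \<nu>" by (simp add: sets)
  have "emeasure \<nu> ?D = emeasure (distr \<nu> borel uminus) ?U"
    by (subst emeasure_distr) (auto simp: space intro!: arg_cong[where f = "emeasure \<nu>"])
  then have D_eq: "emeasure \<nu> ?D = emeasure \<nu> ?U" by (simp add: sym)
  have "(\<integral>\<^sup>+y. ennreal (min 1 ((a * y)\<^sup>2)) \<partial>\<nu>)
      \<le> (\<integral>\<^sup>+y. ennreal (b\<^sup>2) * (ennreal (\<bar>y\<bar>\<^sup>2) * indicator ?S y) + (indicator ?U y + indicator ?D y) \<partial>\<nu>)"
  proof (rule nn_integral_mono)
    fix y
    show "ennreal (min 1 ((a * y)\<^sup>2))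
        \<le> ennreal (b\<^sup>2) * (ennreal (\<bar>y\<bar>\<^sup>2) * indicator ?S y) + (indicator ?U y + indicator ?D y)"
    proof (cases "b * \<bar>y\<bar> \<le> \<epsilon>")
      case True
      have "ennreal (min 1 ((a * y)\<^sup>2)) \<le> ennreal (b\<^sup>2 * \<bar>y\<bar>\<^sup>2)"
        using b(2) by (intro ennreal_leI) (auto simp: power_mult_distrib)
      also have "\<dots> = ennreal (b\<^sup>2) * (ennreal (\<bar>y\<bar>\<^sup>2) * indicator ?S y)"
        using True by (simp add: ennreal_mult)
      finally show ?thesis by (rule order_trans) simp
    next
      case False
      then have "y \<in> ?U \<or> y \<in> ?D"
        using b(1) by (auto simp: pos_divide_le_eq mult.commute abs_if split: if_splits)
      then have "(1::ennreal) \<le> indicator ?U y + indicator ?D y"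
        by (auto simp: indicator_def)
      moreover have "ennreal (min 1 ((a * y)\<^sup>2)) \<le> 1"
        by (simp add: ennreal_le_1)
      ultimately show ?thesis by (meson add_increasing order_trans zero_le)
    qed
  qed
  also have "\<dots> = ennreal (b\<^sup>2) * (\<integral>\<^sup>+ y \<in> ?S. ennreal (\<bar>y\<bar>\<^sup>2) \<partial>\<nu>) + (emeasure \<nu> ?U + emeasure \<nu> ?D)"
    by (simp add: nn_integral_add nn_integral_cmult)
  finally show ?thesis by (simp add: D_eq mult_2)
qed

context prob_space
begin

section \<open>Independence, symmetry and size of the increments\<close>

text \<open>The probability of a finite intersection factors first over the rows and
  then within each row. Here \<open>P n\<close> will be the whole path of the \<open>n\<close>-th process and \<open>g n i\<close> one of its
  increments.\<close>

lemma indep_vars_rows: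
  assumes fin: "finite F" and rows: "indep_vars N P F"
    and entries: "\<And>n. n \<in> F \<Longrightarrow> indep_vars (\<lambda>_. K) (\<lambda>i \<omega>. g n i (P n \<omega>)) I"
    and g: "\<And>n i. n \<in> F \<Longrightarrow> i \<in> I \<Longrightarrow> g n i \<in> N n \<rightarrow>\<^sub>M K"
  shows "indep_vars (\<lambda>_. K) (\<lambda>(n, i) \<omega>. g n i (P n \<omega>)) (F \<times> I)"
  unfolding indep_vars_def2
proof (intro conjI ballI indep_setsI)
  have P: "P n \<in> M \<rightarrow>\<^sub>M N n" if "n \<in> F" for n
    using rows that by (auto simp: indep_vars_def)
  show meas: "(case x of (n, i) \<Rightarrow> \<lambda>\<omega>. g n i (P n \<omega>)) \<in> M \<rightarrow>\<^sub>M K" if "x \<in> F \<times> I" for x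
    using that P g by (auto intro: measurable_compose)
  then show "{(case x of (n, i) \<Rightarrow> \<lambda>\<omega>. g n i (P n \<omega>)) -` A \<inter> space M |A. A \<in> sets K} \<subseteq> events"
    if "x \<in> F \<times> I" for x
    using that by (auto intro!: measurable_sets)
  fix A J
  assume J: "J \<noteq> {}" "J \<subseteq> F \<times> I" "finite J"
    and "\<forall>x\<in>J. A x \<in> {(case x of (n, i) \<Rightarrow> \<lambda>\<omega>. g n i (P n \<omega>)) -` A \<inter> space M |A. A \<in> sets K}"
  then have "\<forall>x\<in>J. \<exists>B. B \<in> sets K \<and> A x = (case x of (n, i) \<Rightarrow> \<lambda>\<omega>. g n i (P n \<omega>)) -` B \<inter> space M"
    by blast
  from bchoice[OF this] obtain B where
    BA: "\<forall>x\<in>J. B x \<in> sets K \<and> A x = (case x of (n, i) \<Rightarrow> \<lambda>\<omega>. g n i (P n \<omega>)) -` B x \<inter> space M" ..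
  then have B: "B x \<in> sets K" if "x \<in> J" for x using that by blast
  from BA have A: "A x = (case x of (n, i) \<Rightarrow> \<lambda>\<omega>. g n i (P n \<omega>)) -` B x \<inter> space M"
    if "x \<in> J" for x using that by blast
  define R where "R n = {i. (n, i) \<in> J}" for n
  define C where "C n = {p \<in> space (N n). \<forall>i\<in>R n. g n i p \<in> B (n, i)}" for n
  have J_eq: "J = Sigma (fst ` J) R" by (force simp: R_def)
  have R: "finite (R n)" "R n \<noteq> {}" "R n \<subseteq> I" "n \<in> F" if "n \<in> fst ` J" for n
  proof -
    have "R n \<subseteq> snd ` J" by (force simp: R_def)
    then show "finite (R n)" using J(3) finite_subset by blast
  qed (use that J in \<open>auto simp: R_def\<close>)
  have C: "C n \<in> sets (N n)" if "n \<in> fst ` J" for n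
    unfolding C_def
  proof (rule sets.sets_Collect_finite_All[OF _ R(1)[OF that]])
    fix i assume i: "i \<in> R n"
    then have "g n i -` B (n, i) \<inter> space (N n) \<in> sets (N n)"
      using g R(3,4)[OF that] B by (intro measurable_sets) (auto simp: R_def)
    moreover have "g n i -` B (n, i) \<inter> space (N n) = {p \<in> space (N n). g n i p \<in> B (n, i)}" by auto
    ultimately show "{p \<in> space (N n). g n i p \<in> B (n, i)} \<in> sets (N n)" by simp
  qed
  have row: "P n -` C n \<inter> space M = (\<Inter>i\<in>R n. A (n, i))" if "n \<in> fst ` J" for n
    using R(2)[OF that] measurable_space[OF P[OF R(4)[OF that]]] A
    by (auto simp: C_def R_def)
  have "(\<Inter>x\<in>J. A x) = (\<Inter>n\<in>fst ` J. P n -` C n \<inter> space M)"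
    using J(1) by (subst J_eq) (auto simp: row)
  also have "prob \<dots> = (\<Prod>n\<in>fst ` J. prob (P n -` C n \<inter> space M))"
    using J C R(4) by (intro indep_varsD_finite[OF indep_vars_subset[OF rows]]) auto
  also have "\<dots> = (\<Prod>n\<in>fst ` J. \<Prod>i\<in>R n. prob (A (n, i)))"
  proof (rule prod.cong[OF refl])
    fix n assume n: "n \<in> fst ` J"
    have "prob (\<Inter>i\<in>R n. (\<lambda>\<omega>. g n i (P n \<omega>)) -` B (n, i) \<inter> space M)
        = (\<Prod>i\<in>R n. prob ((\<lambda>\<omega>. g n i (P n \<omega>)) -` B (n, i) \<inter> space M))"
      using R[OF n] B
      by (intro indep_varsD_finite[OF indep_vars_subset[OF entries]]) (auto simp: R_def)
    moreover have "A (n, i) = (\<lambda>\<omega>. g n i (P n \<omega>)) -` B (n, i) \<inter> space M" if "i \<in> R n" for i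
      using A[of "(n, i)"] that by (simp add: R_def)
    ultimately show "prob (P n -` C n \<inter> space M) = (\<Prod>i\<in>R n. prob (A (n, i)))"
      by (simp add: row[OF n])
  qed
  also have "\<dots> = (\<Prod>x\<in>J. prob (A x))"
    using J(3) R(1) by (subst (2) J_eq) (auto simp: prod.Sigma case_prod_unfold)
  finally show "prob (\<Inter>x\<in>J. A x) = (\<Prod>x\<in>J. prob (A x))" .
qed

lemma distr_uminus_eq_of_char_even:
  fixes X :: "'a \<Rightarrow> real"
  assumes [measurable]: "X \<in> borel_measurable M"
    and even: "\<And>\<theta>. char (distr M borel X) (- \<theta>) = char (distr M borel X) \<theta>"
  shows "distr M borel (\<lambda>\<omega>. - X \<omega>) = distr M borel X"
proof (rule Levy_uniqueness)
  show "real_distribution (distr M borel (\<lambda>\<omega>. - X \<omega>))" "real_distribution (distr M borel X)"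
    by (simp_all add: real_distribution_distr)
  show "char (distr M borel (\<lambda>\<omega>. - X \<omega>)) = char (distr M borel X)"
  proof
    fix \<theta>
    have "char (distr M borel (\<lambda>\<omega>. - X \<omega>)) \<theta> = char (distr M borel X) (- \<theta>)"
      unfolding char_def by (simp add: integral_distr)
    then show "char (distr M borel (\<lambda>\<omega>. - X \<omega>)) \<theta> = char (distr M borel X) \<theta>"
      by (simp add: even)
  qed
qed

text \<open>The exponent of the characteristic function is even and linear in time, so the increments are
  symmetric and their truncated second moment is at most proportional to their duration.\<close>

lemma levy_increment:
  fixes L :: "real \<Rightarrow> 'a \<Rightarrow> real" and a :: real
  assumes \<nu>: "symmetric_levy_measure \<nu>" and L: "symmetric_pure_jump_levy_process M \<nu> L"
    and st: "0 \<le> s" "s \<le> t"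
    and \<kappa>: "(\<integral>\<^sup>+y. ennreal (min 1 ((a * y)\<^sup>2)) \<partial>\<nu>) = ennreal \<kappa>" "0 \<le> \<kappa>"
  defines "X \<equiv> \<lambda>\<omega>. a * (L t \<omega> - L s \<omega>)"
  shows "X \<in> borel_measurable M"
    and "distr M borel (\<lambda>\<omega>. - X \<omega>) = distr M borel X"
    and "expectation (\<lambda>\<omega>. min 1 ((X \<omega>)\<^sup>2)) \<le> 3 * (t - s) * \<kappa>"
proof -
  have levy: "levy_process M L"
    and chf: "\<And>t \<theta>. 0 \<le> t \<Longrightarrow> char (distr M borel (L t)) \<theta>
        = complex_of_real (exp (- t * (\<integral>y. 1 - cos (\<theta> * y) \<partial>\<nu>)))"
    using L by (auto simp: symmetric_pure_jump_levy_process_def)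
  have [measurable]: "L u \<in> borel_measurable M" if "0 \<le> u" for u
    using levy that by (auto simp: levy_process_def)
  let ?D = "\<lambda>\<omega>. L t \<omega> - L s \<omega>"
  have D[measurable]: "?D \<in> borel_measurable M" using st by simp
  then show X[measurable]: "X \<in> borel_measurable M" by (simp add: X_def)
  have "distr M borel (\<lambda>\<omega>. L (s + (t - s)) \<omega> - L s \<omega>) = distr M borel (L (t - s))"
    using levy st unfolding levy_process_def by (metis diff_ge_0_iff_ge)
  then have chD: "char (distr M borel ?D) \<theta>
      = complex_of_real (exp (- (t - s) * (\<integral>y. 1 - cos (\<theta> * y) \<partial>\<nu>)))" for \<theta>
    using chf[of "t - s" \<theta>] st by simp
  have chX: "char (distr M borel X) \<theta> = char (distr M borel ?D) (a * \<theta>)" for \<theta>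
    unfolding char_def X_def by (simp add: integral_distr mult_ac)
  show "distr M borel (\<lambda>\<omega>. - X \<omega>) = distr M borel X"
    by (rule distr_uminus_eq_of_char_even[OF X]) (simp add: chX chD)
  have "ennreal (expectation (\<lambda>\<omega>. min 1 ((X \<omega>)\<^sup>2))) = (\<integral>\<^sup>+\<omega>. ennreal (min 1 ((X \<omega>)\<^sup>2)) \<partial>M)"
    by (intro nn_integral_eq_integral[symmetric] integrable_const_bound[of _ 1]) auto
  also have "\<dots> \<le> ennreal (3 * (t - s)) * ennreal \<kappa>"
    unfolding X_def \<kappa>(1)[symmetric]
    using st \<nu> chD
    by (intro nn_integral_min_square_le D symmetric_levy_measure_sigma_finite)
       (auto simp: symmetric_levy_measure_def)
  also have "\<dots> = ennreal (3 * (t - s) * \<kappa>)"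
    using st \<kappa>(2) by (simp add: ennreal_mult)
  finally show "expectation (\<lambda>\<omega>. min 1 ((X \<omega>)\<^sup>2)) \<le> 3 * (t - s) * \<kappa>"
    using st \<kappa>(2) by (simp add: ennreal_le_iff)
qed

end

section \<open>A maximal inequality for blocks of the series\<close>

text \<open>\<open>c n\<close> stands for \<open>z \<bullet> e n\<close>, and \<open>\<kappa> n\<close> is the only quantity through which the Levy measures enter the
  estimates.\<close>

locale levy_driven_series = prob_space M for M :: "'w measure" +
  fixes L X :: "nat \<Rightarrow> real \<Rightarrow> 'w \<Rightarrow> real" and \<nu> :: "nat \<Rightarrow> real measure"
    and \<gamma> \<sigma> c \<kappa> :: "nat \<Rightarrow> real"
  assumes \<gamma>_nonneg: "0 \<le> \<gamma> n"
    and levy_measure: "symmetric_levy_measure (\<nu> n)"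
    and levy: "symmetric_pure_jump_levy_process M (\<nu> n) (L n)"
    and indep: "indep_processes M L"
    and integral: "t \<in> {0..1} \<Longrightarrow>
      is_stochastic_integral M (\<lambda>s. exp (- \<gamma> n * (t - s)) * \<sigma> n) (L n) t (X n t)"
    and \<kappa>: "(\<integral>\<^sup>+y. ennreal (min 1 ((c n * \<sigma> n * y)\<^sup>2)) \<partial>\<nu> n) = ennreal (\<kappa> n)"
    and \<kappa>_nonneg: "0 \<le> \<kappa> n"
begin

lemma L_measurable: "0 \<le> t \<Longrightarrow> L n t \<in> borel_measurable M"
  using levy[of n] by (auto simp: symmetric_pure_jump_levy_process_def levy_process_def)

lemma X_measurable: "t \<in> {0..1} \<Longrightarrow> X n t \<in> borel_measurable M"
  using integral[of t n] by (simp add: is_stochastic_integral_def)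

definition increment :: "nat \<Rightarrow> nat \<times> nat \<Rightarrow> 'w \<Rightarrow> real" where
  "increment k = (\<lambda>(n, i) \<omega>. c n * \<sigma> n * (L n (real (Suc i) / 2 ^ k) \<omega> - L n (real i / 2 ^ k) \<omega>))"

definition decay :: "nat \<Rightarrow> nat \<Rightarrow> nat \<Rightarrow> real" where
  "decay k n l = (if l = 0 then 0 else exp (- \<gamma> n * (real l / 2 ^ k)))"

lemma indep_increments:
  assumes fin: "finite F"
  shows "indep_vars (\<lambda>_. borel) (increment k) (F \<times> {..<m})"
proof -
  let ?p = "\<lambda>i. real i / 2 ^ k"
  let ?g = "\<lambda>n i f. c n * \<sigma> n * (f (?p (Suc i)) - f (?p i))"
  let ?P = "\<lambda>n \<omega>. \<lambda>t\<in>{0..}. L n t \<omega>"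
  have "indep_vars (\<lambda>_. borel) (\<lambda>(n, i) \<omega>. ?g n i (?P n \<omega>)) (F \<times> {..<m})"
  proof (rule indep_vars_rows[OF fin, where P = ?P and g = ?g and N = "\<lambda>_. PiM {0..} (\<lambda>_. borel)"])
    show "indep_vars (\<lambda>_. PiM {0..} (\<lambda>_. borel)) ?P F"
      using indep indep_vars_subset[of _ _ UNIV F] by (simp add: indep_processes_def)
    fix n
    have "levy_process M (L n)"
      using levy[of n] by (simp add: symmetric_pure_jump_levy_process_def)
    then have *: "\<forall>m (p::nat \<Rightarrow> real). 0 \<le> p 0 \<and> (\<forall>i<m. p i < p (Suc i)) \<longrightarrow>
        indep_vars (\<lambda>_. borel) (\<lambda>i \<omega>. L n (p (Suc i)) \<omega> - L n (p i) \<omega>) {..<m}"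
      unfolding levy_process_def by (elim conjE)
    have "indep_vars (\<lambda>_. borel) (\<lambda>i \<omega>. L n (?p (Suc i)) \<omega> - L n (?p i) \<omega>) {..<m}"
      by (rule *[rule_format, of ?p m]) (simp add: divide_strict_right_mono)
    from indep_vars_compose2[OF this, of "\<lambda>_ x. c n * \<sigma> n * x" "\<lambda>_. borel"]
    show "indep_vars (\<lambda>_. borel) (\<lambda>i \<omega>. ?g n i (?P n \<omega>)) {..<m}" by simp
    fix i
    show "?g n i \<in> borel_measurable (PiM {0..} (\<lambda>_. borel))"
      by (intro borel_measurable_times borel_measurable_const borel_measurable_diff
          measurable_component_singleton) auto
  qed
  then show ?thesis by (simp add: increment_def[abs_def] case_prod_unfold)
qed

text \<open>The \<open>2 ^ k\<close> increments of the row \<open>n\<close> contribute at most \<open>3 * \<kappa> n / 2 ^ k\<close> each, so the bound does not depend on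
  the mesh.\<close>

lemma prob_grid_sum_le:
  assumes fin: "finite F" and \<eta>: "0 < \<eta>"
  shows "prob {\<omega>\<in>space M. \<exists>j\<le>2 ^ k. \<eta> < \<bar>filtered_sum F (2 ^ k) (decay k) (increment k) j \<omega>\<bar>}
           \<le> (3 + 96 / \<eta>\<^sup>2) * (\<Sum>n\<in>F. \<kappa> n)"
proof -
  have inc: "increment k (n, i) \<in> borel_measurable M"
      "distr M borel (\<lambda>\<omega>. - increment k (n, i) \<omega>) = distr M borel (increment k (n, i))"
      "expectation (\<lambda>\<omega>. min 1 ((increment k (n, i) \<omega>)\<^sup>2)) \<le> 3 * (1 / 2 ^ k) * \<kappa> n" for n i
  proof -
    note * = levy_increment[OF levy_measure levy _ _ \<kappa> \<kappa>_nonneg,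
        of "real i / 2 ^ k" "real (Suc i) / 2 ^ k" n]
    have len: "real (Suc i) / 2 ^ k - real i / 2 ^ k = 1 / 2 ^ k"
      by (simp add: diff_divide_distrib[symmetric])
    show "increment k (n, i) \<in> borel_measurable M"
      "distr M borel (\<lambda>\<omega>. - increment k (n, i) \<omega>) = distr M borel (increment k (n, i))"
      "expectation (\<lambda>\<omega>. min 1 ((increment k (n, i) \<omega>)\<^sup>2)) \<le> 3 * (1 / 2 ^ k) * \<kappa> n"
      using * unfolding len increment_def by (simp_all add: divide_right_mono)
  qed
  have kernel: "antimono_on {0<..} (decay k n) \<and> decay k n 0 = 0
      \<and> (\<forall>l. 0 \<le> decay k n l \<and> decay k n l \<le> 1)" for n
  proof (intro conjI allI)
    show "antimono_on {0<..} (decay k n)"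
      using \<gamma>_nonneg[of n]
      by (auto simp: monotone_on_def decay_def intro!: mult_left_mono divide_right_mono)
    show "decay k n l \<le> 1" for l
      using \<gamma>_nonneg[of n] by (simp add: decay_def)
  qed (auto simp: decay_def)
  have "prob {\<omega>\<in>space M. \<exists>j\<le>2 ^ k. \<eta> < \<bar>filtered_sum F (2 ^ k) (decay k) (increment k) j \<omega>\<bar>}
      \<le> (1 + 32 / \<eta>\<^sup>2) * (\<Sum>x\<in>F \<times> {..<2 ^ k}. expectation (\<lambda>\<omega>. min 1 ((increment k x \<omega>)\<^sup>2)))"
    by (rule prob_filtered_sum_decreasing_le[OF fin indep_increments[OF fin] _ kernel \<eta>])
       (use inc(2) in auto)
  also have "\<dots> \<le> (1 + 32 / \<eta>\<^sup>2) * (\<Sum>(n, i)\<in>F \<times> {..<(2::nat) ^ k}. 3 * (1 / 2 ^ k) * \<kappa> n)"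
    using inc(3) by (intro mult_left_mono sum_mono) (auto intro: add_nonneg_nonneg)
  also have "(\<Sum>(n, i)\<in>F \<times> {..<(2::nat) ^ k}. 3 * (1 / 2 ^ k) * \<kappa> n) = 3 * (\<Sum>n\<in>F. \<kappa> n)"
    by (simp add: sum.cartesian_product[symmetric] sum_distrib_left)
  finally show ?thesis by (simp add: algebra_simps)
qed

text \<open>For a grid that refines the dyadic points of level \<open>l\<close>, the filtered row at a dyadic time is a
  left-endpoint sum over a partition, so it approximates the stochastic integral in probability.\<close>

lemma eventually_grid_approx:
  assumes j: "j \<le> 2 ^ l" and \<delta>: "0 < \<delta>" and \<theta>: "0 < \<theta>"
  shows "\<forall>\<^sub>F k in sequentially. prob {\<omega>\<in>space M.
      \<delta> < \<bar>(\<Sum>i<2 ^ k. decay k n (j * 2 ^ (k - l) - i) * increment k (n, i) \<omega>) - c n * X n (real j / 2 ^ l) \<omega>\<bar>} < \<theta>"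
proof -
  let ?t = "real j / 2 ^ l"
  let ?f = "\<lambda>s. exp (- \<gamma> n * (?t - s)) * \<sigma> n"
  \<comment> \<open>The summand 1 covers the case \<open>c n = 0\<close>.\<close>
  define d where "d = \<delta> / (\<bar>c n\<bar> + 1)"
  have d: "0 < d" using \<delta> by (simp add: d_def add_nonneg_pos)
  have t: "?t \<in> {0..1}"
  proof -
    have "real j \<le> 2 ^ l" using j by (metis of_nat_le_iff of_nat_numeral of_nat_power)
    then show ?thesis by simp
  qed
  have "\<exists>h>0. \<forall>m p. partition_of ?t m p \<and> (\<forall>i<m. p (Suc i) - p i < h) \<longrightarrow>
      prob {\<omega>\<in>space M. d < \<bar>(\<Sum>i<m. ?f (p i) * (L n (p (Suc i)) \<omega> - L n (p i) \<omega>)) - X n ?t \<omega>\<bar>} < \<theta>"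
    using integral[OF t, of n] d \<theta> unfolding is_stochastic_integral_def by blast
  then obtain h where h: "0 < h" and approx: "\<And>m p. partition_of ?t m p \<Longrightarrow>
      (\<forall>i<m. p (Suc i) - p i < h) \<Longrightarrow>
      prob {\<omega>\<in>space M. d < \<bar>(\<Sum>i<m. ?f (p i) * (L n (p (Suc i)) \<omega> - L n (p i) \<omega>)) - X n ?t \<omega>\<bar>} < \<theta>"
    by blast
  have "(\<lambda>k. (1 / 2) ^ k :: real) \<longlonglongrightarrow> 0" by (rule LIMSEQ_power_zero) simp
  then have "\<forall>\<^sub>F k in sequentially. (1 / 2 :: real) ^ k < h"
    using h by (rule order_tendstoD)
  with eventually_ge_at_top[of l] show ?thesis
  proof eventually_elim
    case (elim k)
    let ?m = "j * 2 ^ (k - l)"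
    let ?p = "\<lambda>i. real i / 2 ^ k"
    have pow: "(2::nat) ^ k = 2 ^ l * 2 ^ (k - l)" "(2::real) ^ k = 2 ^ l * 2 ^ (k - l)"
      using elim(1) by (simp_all flip: power_add)
    have m: "?m \<le> 2 ^ k" unfolding pow(1) using j by simp
    have mt: "real ?m / 2 ^ k = ?t" unfolding pow(2) by simp
    have part: "partition_of ?t ?m ?p"
      unfolding partition_of_def using mt by (simp add: divide_strict_right_mono)
    have mesh: "\<forall>i<?m. ?p (Suc i) - ?p i < h"
      using elim(2) by (simp add: diff_divide_distrib[symmetric] power_one_over)
    let ?S = "\<lambda>\<omega>. \<Sum>i<?m. ?f (?p i) * (L n (?p (Suc i)) \<omega> - L n (?p i) \<omega>)"
    have S_eq: "(\<Sum>i<2 ^ k. decay k n (?m - i) * increment k (n, i) \<omega>) = c n * ?S \<omega>" for \<omega>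
    proof -
      have "(\<Sum>i<2 ^ k. decay k n (?m - i) * increment k (n, i) \<omega>)
          = (\<Sum>i<?m. decay k n (?m - i) * increment k (n, i) \<omega>)"
        using m by (intro sum.mono_neutral_right) (auto simp: decay_def)
      also have "\<dots> = (\<Sum>i<?m. c n * (?f (?p i) * (L n (?p (Suc i)) \<omega> - L n (?p i) \<omega>)))"
      proof (rule sum.cong[OF refl])
        fix i assume "i \<in> {..<?m}"
        then have i: "i < ?m" by simp
        then have "real (?m - i) / 2 ^ k = ?t - ?p i"
          unfolding mt[symmetric] by (simp only: of_nat_diff less_imp_le diff_divide_distrib)
        then show "decay k n (?m - i) * increment k (n, i) \<omega>
            = c n * (?f (?p i) * (L n (?p (Suc i)) \<omega> - L n (?p i) \<omega>))"
          using i by (simp add: decay_def increment_def)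
      qed
      finally show ?thesis by (simp only: sum_distrib_left)
    qed
    have [measurable]: "X n ?t \<in> borel_measurable M" using X_measurable[OF t] .
    have [measurable]: "L n (?p i) \<in> borel_measurable M" for i by (simp add: L_measurable)
    have "prob {\<omega>\<in>space M. \<delta> < \<bar>c n * ?S \<omega> - c n * X n ?t \<omega>\<bar>}
        \<le> prob {\<omega>\<in>space M. d < \<bar>?S \<omega> - X n ?t \<omega>\<bar>}"
    proof (rule finite_measure_mono)
      show "{\<omega>\<in>space M. \<delta> < \<bar>c n * ?S \<omega> - c n * X n ?t \<omega>\<bar>}
          \<subseteq> {\<omega>\<in>space M. d < \<bar>?S \<omega> - X n ?t \<omega>\<bar>}"
      proof safe
        fix \<omega> assume "\<delta> < \<bar>c n * ?S \<omega> - c n * X n ?t \<omega>\<bar>"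
        also have "\<dots> = \<bar>c n\<bar> * \<bar>?S \<omega> - X n ?t \<omega>\<bar>"
          by (simp only: right_diff_distrib[symmetric] abs_mult)
        also have "\<dots> \<le> (\<bar>c n\<bar> + 1) * \<bar>?S \<omega> - X n ?t \<omega>\<bar>"
          by (intro mult_right_mono) auto
        finally show "d < \<bar>?S \<omega> - X n ?t \<omega>\<bar>"
          by (simp add: d_def pos_divide_less_eq add_nonneg_pos mult.commute)
      qed
    qed measurable
    also have "\<dots> < \<theta>" by (rule approx[OF part mesh])
    finally show ?case unfolding S_eq .
  qed
qed

lemma dyadic_mem: "j \<le> 2 ^ l \<Longrightarrow> real j / 2 ^ l \<in> {0..1}"
  by (simp add: divide_le_eq_1)

text \<open>At the finitely many dyadic times of level \<open>l\<close> the grid sums approximate the block in probability,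
  so the mesh-independent bound survives the limit, with \<open>\<eta> / 2\<close> in place of \<open>\<eta>\<close>
  (\<open>384 = 4 * 96\<close>).\<close>

lemma prob_dyadic_level_le:
  assumes fin: "finite F" and \<eta>: "0 < \<eta>"
  shows "prob {\<omega>\<in>space M. \<exists>j\<le>2 ^ l. \<eta> < \<bar>\<Sum>n\<in>F. c n * X n (real j / 2 ^ l) \<omega>\<bar>}
           \<le> (3 + 384 / \<eta>\<^sup>2) * (\<Sum>n\<in>F. \<kappa> n)"
proof (rule field_le_epsilon)
  fix e :: real assume e: "0 < e"
  \<comment> \<open>All \<open>card F\<close> approximation errors together stay below \<open>\<eta> / 2\<close>, and the exceptional events for all
    pairs \<open>(n, j)\<close> together have probability at most \<open>e\<close>.\<close>
  define d where "d = \<eta> / (2 * (real (card F) + 1))"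
  define C :: real where "C = (real (card F) + 1) * (2 ^ l + 1)"
  define \<theta> where "\<theta> = e / C"
  have d: "0 < d" using \<eta> by (simp add: d_def add_nonneg_pos)
  have C: "0 < C" by (simp add: C_def add_nonneg_pos add_pos_pos)
  then have \<theta>: "0 < \<theta>" using e by (simp add: \<theta>_def)
  let ?S = "\<lambda>k n j \<omega>. \<Sum>i<2 ^ k. decay k n (j * 2 ^ (k - l) - i) * increment k (n, i) \<omega>"
  let ?Z = "\<lambda>n j \<omega>. c n * X n (real j / 2 ^ l) \<omega>"
  let ?B = "\<lambda>k n j. {\<omega>\<in>space M. d < \<bar>?S k n j \<omega> - ?Z n j \<omega>\<bar>}"
  have "\<forall>\<^sub>F k in sequentially. \<forall>n\<in>F. \<forall>j\<in>{..2 ^ l}. prob (?B k n j) < \<theta>"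
    using fin d \<theta> by (intro eventually_ball_finite ballI eventually_grid_approx) auto
  from eventually_happens'[OF sequentially_bot eventually_conj[OF eventually_ge_at_top[of l] this]]
  obtain k where k: "l \<le> k" and small: "\<forall>n\<in>F. \<forall>j\<in>{..2 ^ l}. prob (?B k n j) < \<theta>"
    by blast
  have pow: "(2::nat) ^ k = 2 ^ l * 2 ^ (k - l)" using k by (simp flip: power_add)
  have [measurable]: "increment k (n, i) \<in> borel_measurable M" for n i
    using L_measurable by (simp add: increment_def)
  have Z[measurable]: "?Z n j \<in> borel_measurable M" if "j \<le> 2 ^ l" for n j
    using X_measurable[OF dyadic_mem[OF that]] by simp
  have B: "?B k n j \<in> events" if "j \<le> 2 ^ l" for n j
    using Z[OF that, of n] by measurable
  define A where "A = {\<omega>\<in>space M. \<exists>j\<le>2 ^ k. \<eta> / 2 < \<bar>filtered_sum F (2 ^ k) (decay k) (increment k) j \<omega>\<bar>}"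
  have A: "A \<in> events"
    unfolding A_def filtered_sum_def case_prod_unfold by measurable
  have fs: "filtered_sum F (2 ^ k) (decay k) (increment k) (j * 2 ^ (k - l)) \<omega> = (\<Sum>n\<in>F. ?S k n j \<omega>)"
    for j \<omega>
    by (simp add: filtered_sum_def sum.cartesian_product)
  have "{\<omega>\<in>space M. \<exists>j\<le>2 ^ l. \<eta> < \<bar>\<Sum>n\<in>F. ?Z n j \<omega>\<bar>}
      \<subseteq> A \<union> (\<Union>(n, j)\<in>F \<times> {..2 ^ l}. ?B k n j)"
  proof safe
    fix \<omega> j
    assume \<omega>: "\<omega> \<in> space M" "j \<le> 2 ^ l" "\<eta> < \<bar>\<Sum>n\<in>F. ?Z n j \<omega>\<bar>"
      "\<omega> \<notin> (\<Union>(n, j)\<in>F \<times> {..2 ^ l}. ?B k n j)"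
    have le: "\<bar>?S k n j \<omega> - ?Z n j \<omega>\<bar> \<le> d" if "n \<in> F" for n
      using \<omega>(1,2,4) that by (auto simp: not_less)
    have "\<bar>(\<Sum>n\<in>F. ?S k n j \<omega>) - (\<Sum>n\<in>F. ?Z n j \<omega>)\<bar> \<le> (\<Sum>n\<in>F. d)"
      unfolding sum_subtractf[symmetric]
      by (rule order_trans[OF sum_abs sum_mono]) (rule le)
    also have "\<dots> \<le> \<eta> / 2"
      using \<eta> by (simp add: d_def field_simps)
    finally have "\<eta> / 2 < \<bar>\<Sum>n\<in>F. ?S k n j \<omega>\<bar>" using \<omega>(3) by linarith
    moreover have "j * 2 ^ (k - l) \<le> 2 ^ k" unfolding pow using \<omega>(2) by simp
    ultimately show "\<omega> \<in> A" using \<omega>(1) unfolding A_def fs[symmetric] by blast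
  qed
  then have "prob {\<omega>\<in>space M. \<exists>j\<le>2 ^ l. \<eta> < \<bar>\<Sum>n\<in>F. ?Z n j \<omega>\<bar>}
      \<le> prob (A \<union> (\<Union>(n, j)\<in>F \<times> {..2 ^ l}. ?B k n j))"
    using fin A B by (intro finite_measure_mono sets.Un sets.finite_UN) auto
  also have "\<dots> \<le> prob A + prob (\<Union>(n, j)\<in>F \<times> {..2 ^ l}. ?B k n j)"
    using fin A B by (intro measure_Un_le sets.finite_UN) auto
  also have "prob (\<Union>(n, j)\<in>F \<times> {..2 ^ l}. ?B k n j) \<le> (\<Sum>(n, j)\<in>F \<times> {..2 ^ l}. prob (?B k n j))"
    using fin B unfolding case_prod_unfold by (intro finite_measure_subadditive_finite) auto
  also have "\<dots> \<le> (\<Sum>(n, j)\<in>F \<times> {..(2::nat) ^ l}. \<theta>)"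
    using small by (intro sum_mono) (auto intro: less_imp_le)
  also have "\<dots> = real (card F) * (2 ^ l + 1) * \<theta>"
    by (simp add: case_prod_unfold card_cartesian_product algebra_simps)
  also have "\<dots> \<le> C * \<theta>"
    using \<theta> unfolding C_def by (intro mult_right_mono) auto
  also have "\<dots> = e" using C by (simp add: \<theta>_def)
  also have "prob A \<le> (3 + 96 / (\<eta> / 2)\<^sup>2) * (\<Sum>n\<in>F. \<kappa> n)"
    unfolding A_def using \<eta> by (intro prob_grid_sum_le fin) auto
  also have "96 / (\<eta> / 2)\<^sup>2 = 384 / \<eta>\<^sup>2" by (simp add: power_divide)
  finally show "prob {\<omega>\<in>space M. \<exists>j\<le>2 ^ l. \<eta> < \<bar>\<Sum>n\<in>F. ?Z n j \<omega>\<bar>}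
      \<le> (3 + 384 / \<eta>\<^sup>2) * (\<Sum>n\<in>F. \<kappa> n) + e" by simp
qed

text \<open>The exceptional events increase with the dyadic level while their bound does not depend on it, so
  continuity from below applies.\<close>

lemma prob_dyadic_le:
  assumes fin: "finite F" and \<eta>: "0 < \<eta>"
  defines "E \<equiv> {\<omega>\<in>space M. \<exists>l j. j \<le> 2 ^ l \<and> \<eta> < \<bar>\<Sum>n\<in>F. c n * X n (real j / 2 ^ l) \<omega>\<bar>}"
  shows "E \<in> events" and "prob E \<le> (3 + 384 / \<eta>\<^sup>2) * (\<Sum>n\<in>F. \<kappa> n)"
proof -
  define D where "D l = {\<omega>\<in>space M. \<exists>j\<le>2 ^ l. \<eta> < \<bar>\<Sum>n\<in>F. c n * X n (real j / 2 ^ l) \<omega>\<bar>}" for l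
  have E_eq: "E = (\<Union>l. D l)" by (auto simp: E_def D_def)
  have D: "D l \<in> events" for l
  proof -
    have "{\<omega>\<in>space M. \<eta> < \<bar>\<Sum>n\<in>F. c n * X n (real j / 2 ^ l) \<omega>\<bar>} \<in> events" if "j \<le> 2 ^ l" for j
    proof -
      have [measurable]: "X n (real j / 2 ^ l) \<in> borel_measurable M" for n
        using X_measurable[OF dyadic_mem[OF that]] .
      show ?thesis by measurable
    qed
    then have "(\<Union>j\<in>{..2 ^ l}. {\<omega>\<in>space M. \<eta> < \<bar>\<Sum>n\<in>F. c n * X n (real j / 2 ^ l) \<omega>\<bar>}) \<in> events"
      by (intro sets.finite_UN) auto
    also have "(\<Union>j\<in>{..2 ^ l}. {\<omega>\<in>space M. \<eta> < \<bar>\<Sum>n\<in>F. c n * X n (real j / 2 ^ l) \<omega>\<bar>}) = D l"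
      by (auto simp: D_def)
    finally show ?thesis .
  qed
  then show "E \<in> events" unfolding E_eq by auto
  have "D l \<subseteq> D (Suc l)" for l
  proof
    fix \<omega> assume "\<omega> \<in> D l"
    then obtain j where j: "j \<le> 2 ^ l" "\<omega> \<in> space M" "\<eta> < \<bar>\<Sum>n\<in>F. c n * X n (real j / 2 ^ l) \<omega>\<bar>"
      unfolding D_def by blast
    have "real (2 * j) / 2 ^ Suc l = real j / 2 ^ l" by simp
    with j(3) have "\<eta> < \<bar>\<Sum>n\<in>F. c n * X n (real (2 * j) / 2 ^ Suc l) \<omega>\<bar>" by (simp only:)
    moreover have "2 * j \<le> 2 ^ Suc l" using j(1) by simp
    ultimately show "\<omega> \<in> D (Suc l)" using j(2) unfolding D_def by blast
  qed
  then have "incseq D" by (rule incseq_SucI)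
  then have "(\<lambda>l. prob (D l)) \<longlonglongrightarrow> prob E"
    unfolding E_eq using D by (intro finite_Lim_measure_incseq) auto
  then show "prob E \<le> (3 + 384 / \<eta>\<^sup>2) * (\<Sum>n\<in>F. \<kappa> n)"
    by (rule LIMSEQ_le_const2) (use prob_dyadic_level_le[OF fin \<eta>] in \<open>auto simp: D_def\<close>)
qed

end

section \<open>Cadlag functions\<close>

lemma cadlag_on_sum:
  assumes "\<And>n. n \<in> A \<Longrightarrow> cadlag_on T (f n)"
  shows "cadlag_on T (\<lambda>t. \<Sum>n\<in>A. c n * f n t)"
  unfolding cadlag_on_def
proof (intro ballI conjI)
  fix t assume t: "t \<in> T"
  show "continuous (at t within T \<inter> {t..}) (\<lambda>t. \<Sum>n\<in>A. c n * f n t)"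
    using assms t by (intro continuous_intros) (auto simp: cadlag_on_def)
  have "\<forall>n\<in>A. \<exists>l. (f n \<longlongrightarrow> l) (at t within T \<inter> {..<t})"
    using assms t by (simp add: cadlag_on_def)
  from bchoice[OF this] obtain l where "\<forall>n\<in>A. (f n \<longlongrightarrow> l n) (at t within T \<inter> {..<t})" ..
  then have "((\<lambda>t. \<Sum>n\<in>A. c n * f n t) \<longlongrightarrow> (\<Sum>n\<in>A. c n * l n)) (at t within T \<inter> {..<t})"
    by (intro tendsto_intros) auto
  then show "\<exists>l. ((\<lambda>t. \<Sum>n\<in>A. c n * f n t) \<longlongrightarrow> l) (at t within T \<inter> {..<t})" ..
qed

text \<open>Uniform convergence permits the exchange of limits. For the left limit of \<open>g\<close> one first needs that
  the left limits of the \<open>f r\<close> converge; they form a Cauchy sequence by the same uniformity.\<close>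

lemma cadlag_on_uniform_limit:
  assumes f: "\<And>r::nat. cadlag_on T (f r)" and lim: "uniform_limit T f g sequentially"
  shows "cadlag_on T g"
  unfolding cadlag_on_def
proof (intro ballI conjI)
  fix t assume t: "t \<in> T"
  have "(g \<longlongrightarrow> g t) (at t within T \<inter> {t..})"
  proof (rule swap_uniform_limit)
    show "\<forall>\<^sub>F r in sequentially. (f r \<longlongrightarrow> f r t) (at t within T \<inter> {t..})"
      using f t by (auto simp: cadlag_on_def continuous_within)
    show "(\<lambda>r. f r t) \<longlonglongrightarrow> g t" by (rule tendsto_uniform_limitI[OF lim t])
  qed (auto intro: uniform_limit_on_subset[OF lim])
  then show "continuous (at t within T \<inter> {t..}) g" by (simp add: continuous_within)
  let ?F = "at t within T \<inter> {..<t}"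
  show "\<exists>l. (g \<longlongrightarrow> l) ?F"
  proof (cases "?F = bot")
    case False
    have "\<forall>r. \<exists>l. (f r \<longlongrightarrow> l) ?F" using f t by (simp add: cadlag_on_def)
    from choice[OF this] obtain l where l: "\<And>r. (f r \<longlongrightarrow> l r) ?F" by blast
    have "Cauchy l"
    proof (rule metric_CauchyI)
      fix e :: real assume e: "0 < e"
      then obtain N where N: "\<And>r x. N \<le> r \<Longrightarrow> x \<in> T \<Longrightarrow> dist (f r x) (g x) < e / 4"
        using uniform_limitD[OF lim, of "e / 4"] by (auto simp: eventually_sequentially)
      have "dist (l m) (l n) < e" if "N \<le> m" "N \<le> n" for m n
      proof -
        have "dist (f m x) (f n x) \<le> e / 2" if "x \<in> T" for x
          using dist_triangle2[of "f m x" "f n x" "g x"] N[OF \<open>N \<le> m\<close> that] N[OF \<open>N \<le> n\<close> that] by simp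
        then have "\<forall>\<^sub>F x in ?F. dist (f m x) (f n x) \<le> e / 2"
          by (simp add: eventually_at_filter)
        then have "dist (l m) (l n) \<le> e / 2"
          using False by (intro tendsto_upperbound[OF tendsto_dist[OF l l]])
        then show ?thesis using e by simp
      qed
      then show "\<exists>N. \<forall>m\<ge>N. \<forall>n\<ge>N. dist (l m) (l n) < e" by blast
    qed
    then obtain l' where l': "l \<longlonglongrightarrow> l'" using Cauchy_convergent convergent_def by blast
    have "(g \<longlongrightarrow> l') ?F"
      by (rule swap_uniform_limit[OF _ l']) (auto simp: l intro: uniform_limit_on_subset[OF lim])
    then show ?thesis ..
  qed simp
qed

text \<open>Every \<open>t < 1\<close> is a limit from the right of dyadic points of \<open>[0, 1]\<close>, and \<open>1\<close> is itself dyadic.\<close>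

lemma cadlag_on_abs_le_of_dyadic:
  assumes f: "cadlag_on {0..1} f" and dyadic: "\<And>l j. j \<le> 2 ^ l \<Longrightarrow> \<bar>f (real j / 2 ^ l)\<bar> \<le> B"
    and t: "t \<in> {0..1}"
  shows "\<bar>f t\<bar> \<le> B"
proof (cases "t = 1")
  case True
  then show ?thesis using dyadic[of 1 0] by simp
next
  case False
  with t have t: "0 \<le> t" "t < 1" by auto
  define j where "j l = nat \<lfloor>t * 2 ^ l\<rfloor> + 1" for l :: nat
  define q where "q l = real (j l) / 2 ^ l" for l
  have j_real: "real (j l) = real_of_int \<lfloor>t * 2 ^ l\<rfloor> + 1" for l
    using t by (simp add: j_def)
  have j_le: "j l \<le> 2 ^ l" for l
  proof -
    have "t * 2 ^ l < 2 ^ l" using t by simp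
    then have "\<lfloor>t * 2 ^ l\<rfloor> < 2 ^ l" by (simp add: floor_less_iff)
    then have "nat \<lfloor>t * 2 ^ l\<rfloor> < 2 ^ l" by (simp add: nat_less_iff)
    then show ?thesis unfolding j_def by linarith
  qed
  have q_gt: "t < q l" for l
    unfolding q_def j_real by (simp add: pos_less_divide_eq)
  have q_le: "q l \<le> t + (1 / 2) ^ l" for l
  proof -
    have "real (j l) \<le> t * 2 ^ l + 1" unfolding j_real by linarith
    then have "q l \<le> (t * 2 ^ l + 1) / 2 ^ l" unfolding q_def by (rule divide_right_mono) simp
    also have "\<dots> = t + (1 / 2) ^ l" by (simp add: add_divide_distrib power_one_over)
    finally show ?thesis .
  qed
  have q1: "q l \<le> 1" for l
  proof -
    have "real (j l) \<le> 2 ^ l" using j_le[of l] by (metis of_nat_le_iff of_nat_numeral of_nat_power)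
    then show ?thesis by (simp add: q_def)
  qed
  have "(\<lambda>l. t + (1 / 2) ^ l) \<longlonglongrightarrow> t + 0"
    by (intro tendsto_intros LIMSEQ_power_zero) simp
  then have upper: "(\<lambda>l. t + (1 / 2) ^ l) \<longlonglongrightarrow> t" by simp
  have q_lim: "q \<longlonglongrightarrow> t"
  proof (rule tendsto_sandwich[OF _ _ tendsto_const upper])
    show "\<forall>\<^sub>F l in sequentially. t \<le> q l" "\<forall>\<^sub>F l in sequentially. q l \<le> t + (1 / 2) ^ l"
      using q_gt q_le by (simp_all add: less_imp_le)
  qed
  have right: "continuous (at t within {0..1} \<inter> {t..}) f"
    using f t by (simp add: cadlag_on_def)
  have "q l \<in> {0..1} \<inter> {t..}" for l
    using q_gt[of l] q1[of l] t by auto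
  from continuous_within_tendsto_compose'[OF right this q_lim]
  have "(\<lambda>l. f (q l)) \<longlonglongrightarrow> f t" .
  then have "(\<lambda>l. \<bar>f (q l)\<bar>) \<longlonglongrightarrow> \<bar>f t\<bar>" by (rule tendsto_rabs)
  then show ?thesis
    by (rule LIMSEQ_le_const2) (use dyadic j_le in \<open>auto simp: q_def\<close>)
qed

section \<open>Uniform convergence along a subsequence\<close>

lemma summable_rapid_subsequence:
  fixes \<kappa> \<delta> :: "nat \<Rightarrow> real"
  assumes "summable \<kappa>" and "\<And>r. 0 < \<delta> r"
  obtains N :: "nat \<Rightarrow> nat" where "strict_mono N" and "\<And>r. sum \<kappa> {N r..<N (Suc r)} < \<delta> r"
proof -
  have "\<forall>r. \<exists>N. \<forall>m\<ge>N. \<forall>n. norm (sum \<kappa> {m..<n}) < \<delta> r"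
    using assms unfolding summable_Cauchy by blast
  from choice[OF this] obtain N where N: "\<And>r m n. N r \<le> m \<Longrightarrow> norm (sum \<kappa> {m..<n}) < \<delta> r"
    by blast
  define N' where "N' r = r + (\<Sum>i\<le>r. N i)" for r
  have "strict_mono N'" by (rule strict_mono_Suc_iff[THEN iffD2]) (simp add: N'_def)
  moreover have "sum \<kappa> {N' r..<N' (Suc r)} < \<delta> r" for r
  proof -
    have "N r \<le> (\<Sum>i\<le>r. N i)" by (rule member_le_sum) auto
    then have "N r \<le> N' r" by (simp add: N'_def)
    from N[OF this, of "N' (Suc r)"] show ?thesis by simp
  qed
  ultimately show ?thesis by (rule that)
qed

context levy_driven_series
begin

text \<open>Blocks are chosen so that \<open>\<Sum>\<kappa>\<close> over the \<open>r\<close>-th block is below \<open>(1 / 8) ^ r\<close>. For the level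
  \<open>(1 / 2) ^ r\<close> the maximal inequality then gives a probability of order
  \<open>4 ^ r * (1 / 8) ^ r = (1 / 2) ^ r\<close>, and Borel-Cantelli applies.\<close>

lemma eventually_blocks_uniformly_small:
  assumes \<kappa>_summable: "summable \<kappa>"
    and cadlag: "\<And>n. AE \<omega> in M. cadlag_on {0..1} (\<lambda>t. X n t \<omega>)"
  obtains N :: "nat \<Rightarrow> nat" where "strict_mono N"
    and "AE \<omega> in M. (\<forall>n. cadlag_on {0..1} (\<lambda>t. X n t \<omega>)) \<and>
      (\<forall>\<^sub>F r in sequentially. \<forall>t\<in>{0..1}. \<bar>\<Sum>n\<in>{N r..<N (Suc r)}. c n * X n t \<omega>\<bar> \<le> (1 / 2) ^ r)"
proof -
  obtain N where N: "strict_mono N" "\<And>r. sum \<kappa> {N r..<N (Suc r)} < (1 / 8) ^ r"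
    by (rule summable_rapid_subsequence[OF \<kappa>_summable, of "\<lambda>r. (1 / 8) ^ r"]) auto
  define E where "E r = {\<omega>\<in>space M. \<exists>l j. j \<le> 2 ^ l \<and>
      (1 / 2) ^ r < \<bar>\<Sum>n\<in>{N r..<N (Suc r)}. c n * X n (real j / 2 ^ l) \<omega>\<bar>}" for r
  have E: "E r \<in> events" "prob (E r) \<le> 387 * (1 / 2) ^ r" for r
  proof -
    note bound = prob_dyadic_le[of "{N r..<N (Suc r)}" "(1 / 2) ^ r", folded E_def]
    show "E r \<in> events" using bound(1) by simp
    have "prob (E r) \<le> (3 + 384 / ((1 / 2) ^ r)\<^sup>2) * sum \<kappa> {N r..<N (Suc r)}"
      using bound(2) by simp
    also have "\<dots> \<le> (387 * 4 ^ r) * (1 / 8) ^ r"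
    proof (rule mult_mono)
      have "((1 / 2) ^ r)\<^sup>2 = (1 / 4 :: real) ^ r"
        by (simp add: power2_eq_square flip: power_mult_distrib)
      moreover have "(1::real) \<le> 4 ^ r" by simp
      ultimately show "3 + 384 / ((1 / 2) ^ r)\<^sup>2 \<le> (387 * 4 ^ r :: real)"
        by (simp add: power_one_over)
    qed (use N(2)[of r] \<kappa>_nonneg in \<open>auto intro: sum_nonneg\<close>)
    also have "\<dots> = 387 * (1 / 2) ^ r"
      by (simp flip: power_mult_distrib)
    finally show "prob (E r) \<le> 387 * (1 / 2) ^ r" .
  qed
  have "summable (\<lambda>r. prob (E r))"
  proof (rule summable_comparison_test')
    show "summable (\<lambda>r. 387 * (1 / 2 :: real) ^ r)"
      by (intro summable_mult summable_geometric) simp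
    show "norm (prob (E r)) \<le> 387 * (1 / 2) ^ r" if "0 \<le> r" for r using E(2) by simp
  qed
  then have BC: "AE \<omega> in M. \<forall>\<^sub>F r in sequentially. \<omega> \<in> space M - E r"
    by (intro borel_cantelli_AE1 E) (auto simp: emeasure_eq_measure)
  have "AE \<omega> in M. \<forall>n. cadlag_on {0..1} (\<lambda>t. X n t \<omega>)"
    using cadlag by (simp add: AE_all_countable)
  with BC have "AE \<omega> in M. (\<forall>n. cadlag_on {0..1} (\<lambda>t. X n t \<omega>)) \<and>
      (\<forall>\<^sub>F r in sequentially. \<forall>t\<in>{0..1}. \<bar>\<Sum>n\<in>{N r..<N (Suc r)}. c n * X n t \<omega>\<bar> \<le> (1 / 2) ^ r)"
  proof eventually_elim
    case (elim \<omega>)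
    have "\<forall>t\<in>{0..1}. \<bar>\<Sum>n\<in>{N r..<N (Suc r)}. c n * X n t \<omega>\<bar> \<le> (1 / 2) ^ r"
      if "\<omega> \<in> space M - E r" for r
    proof
      fix t :: real assume t: "t \<in> {0..1}"
      show "\<bar>\<Sum>n\<in>{N r..<N (Suc r)}. c n * X n t \<omega>\<bar> \<le> (1 / 2) ^ r"
      proof (rule cadlag_on_abs_le_of_dyadic[OF _ _ t])
        show "cadlag_on {0..1} (\<lambda>t. \<Sum>n\<in>{N r..<N (Suc r)}. c n * X n t \<omega>)"
          using elim(2) by (intro cadlag_on_sum) simp
        show "\<bar>\<Sum>n\<in>{N r..<N (Suc r)}. c n * X n (real j / 2 ^ l) \<omega>\<bar> \<le> (1 / 2) ^ r" if "j \<le> 2 ^ l" for j l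
          using \<open>\<omega> \<in> space M - E r\<close> that unfolding E_def by (auto simp: not_less)
      qed
    qed
    with elim show ?case by (auto elim: eventually_mono)
  qed
  with N(1) show ?thesis by (rule that)
qed

text \<open>The modification is the limit of the partial sums along the subsequence, set to \<open>0\<close> on a measurable
  null set outside which that limit is uniform. For fixed \<open>t\<close> it agrees with the sum of the series
  almost surely, since a subsequence of the partial sums has the same limit.\<close>

lemma has_cadlag_modification_series:
  assumes \<kappa>_summable: "summable \<kappa>"
    and cadlag: "\<And>n. AE \<omega> in M. cadlag_on {0..1} (\<lambda>t. X n t \<omega>)"
    and conv: "\<And>t. t \<in> {0..1} \<Longrightarrow> AE \<omega> in M. summable (\<lambda>n. c n * X n t \<omega>)"
  shows "has_cadlag_modification M {0..1} (\<lambda>t \<omega>. \<Sum>n. c n * X n t \<omega>)"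
proof -
  obtain N where N: "strict_mono N"
    and good: "AE \<omega> in M. (\<forall>n. cadlag_on {0..1} (\<lambda>t. X n t \<omega>)) \<and>
      (\<forall>\<^sub>F r in sequentially. \<forall>t\<in>{0..1}. \<bar>\<Sum>n\<in>{N r..<N (Suc r)}. c n * X n t \<omega>\<bar> \<le> (1 / 2) ^ r)"
    by (rule eventually_blocks_uniformly_small[OF \<kappa>_summable cadlag])
  define G where "G \<omega> \<longleftrightarrow> (\<forall>n. cadlag_on {0..1} (\<lambda>t. X n t \<omega>)) \<and>
      (\<forall>\<^sub>F r in sequentially. \<forall>t\<in>{0..1}. \<bar>\<Sum>n\<in>{N r..<N (Suc r)}. c n * X n t \<omega>\<bar> \<le> (1 / 2) ^ r)" for \<omega>
  obtain A where bad: "{\<omega>\<in>space M. \<not> G \<omega>} \<subseteq> A" and A0: "emeasure M A = 0"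
    and A[measurable]: "A \<in> events"
    by (rule AE_E[OF good[folded G_def]])
  define P where "P \<omega> r t = (\<Sum>n\<in>{0..<N r}. c n * X n t \<omega>)" for \<omega> r t
  define Z where "Z t \<omega> = (if \<omega> \<in> A then 0 else lim (\<lambda>r. P \<omega> r t))" for t \<omega>
  show ?thesis
    unfolding has_cadlag_modification_def
  proof (intro exI[of _ Z] conjI ballI)
    fix t :: real assume t: "t \<in> {0..1}"
    have [measurable]: "(\<lambda>\<omega>. P \<omega> r t) \<in> borel_measurable M" for r
      unfolding P_def using X_measurable[OF t] by measurable
    have [measurable]: "(\<lambda>\<omega>. lim (\<lambda>r. P \<omega> r t)) \<in> borel_measurable M"
      by (rule borel_measurable_lim_metric) measurable
    show "Z t \<in> borel_measurable M"
      unfolding Z_def by measurable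
    have "AE \<omega> in M. \<omega> \<notin> A" using A A0 by (intro AE_not_in) auto
    with conv[OF t] show "AE \<omega> in M. Z t \<omega> = (\<Sum>n. c n * X n t \<omega>)"
    proof eventually_elim
      case (elim \<omega>)
      from LIMSEQ_subseq_LIMSEQ[OF summable_LIMSEQ[OF elim(1)] N]
      have "(\<lambda>r. P \<omega> r t) \<longlonglongrightarrow> (\<Sum>n. c n * X n t \<omega>)"
        by (simp add: P_def comp_def atLeast0LessThan)
      then show ?case using elim(2) by (simp add: Z_def limI)
    qed
  next
    fix \<omega> assume \<omega>: "\<omega> \<in> space M"
    show "cadlag_on {0..1} (\<lambda>t. Z t \<omega>)"
    proof (cases "\<omega> \<in> A")
      case True
      then show ?thesis by (auto simp: Z_def cadlag_on_def)
    next
      case False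
      with bad \<omega> have "G \<omega>" by blast
      then have cad: "\<And>n. cadlag_on {0..1} (\<lambda>t. X n t \<omega>)"
        and small: "\<forall>\<^sub>F r in sequentially. \<forall>t\<in>{0..1}. \<bar>\<Sum>n\<in>{N r..<N (Suc r)}. c n * X n t \<omega>\<bar> \<le> (1 / 2) ^ r"
        by (auto simp: G_def)
      have diff: "P \<omega> (Suc r) t - P \<omega> r t = (\<Sum>n\<in>{N r..<N (Suc r)}. c n * X n t \<omega>)" for r t
        unfolding P_def using N by (intro sum_diff_nat_ivl) (auto simp: strict_mono_less_eq)
      have "uniform_limit {0..1} (\<lambda>r t. \<Sum>i<r. P \<omega> (Suc i) t - P \<omega> i t)
          (\<lambda>t. \<Sum>i. P \<omega> (Suc i) t - P \<omega> i t) sequentially"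
      proof (rule Weierstrass_m_test_ev)
        show "\<forall>\<^sub>F r in sequentially. \<forall>t\<in>{0..1}. norm (P \<omega> (Suc r) t - P \<omega> r t) \<le> (1 / 2) ^ r"
          using small by (simp add: diff)
        show "summable (\<lambda>r. (1 / 2 :: real) ^ r)" by (rule summable_geometric) simp
      qed
      moreover have "uniform_limit {0..1} (\<lambda>_. P \<omega> 0) (P \<omega> 0) sequentially"
        by (rule uniform_limit_const)
      ultimately have "uniform_limit {0..1} (\<lambda>r t. P \<omega> 0 t + (\<Sum>i<r. P \<omega> (Suc i) t - P \<omega> i t))
          (\<lambda>t. P \<omega> 0 t + (\<Sum>i. P \<omega> (Suc i) t - P \<omega> i t)) sequentially"
        by (intro uniform_limit_add)
      moreover have "(\<lambda>r t. P \<omega> 0 t + (\<Sum>i<r. P \<omega> (Suc i) t - P \<omega> i t)) = P \<omega>"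
      proof (intro ext)
        show "P \<omega> 0 t + (\<Sum>i<r. P \<omega> (Suc i) t - P \<omega> i t) = P \<omega> r t" for r t
          using sum_lessThan_telescope[of "\<lambda>i. P \<omega> i t" r] by simp
      qed
      ultimately have ul: "uniform_limit {0..1} (P \<omega>) (\<lambda>t. P \<omega> 0 t + (\<Sum>i. P \<omega> (Suc i) t - P \<omega> i t)) sequentially"
        by (simp only:)
      have "Z t \<omega> = P \<omega> 0 t + (\<Sum>i. P \<omega> (Suc i) t - P \<omega> i t)" if "t \<in> {0..1}" for t
        using False limI[OF tendsto_uniform_limitI[OF ul that]] by (simp add: Z_def)
      then have "uniform_limit {0..1} (P \<omega>) (\<lambda>t. Z t \<omega>) sequentially"
        by (intro uniform_limit_cong'[THEN iffD1, OF _ _ ul]) auto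
      then show ?thesis
        by (rule cadlag_on_uniform_limit[rotated]) (unfold P_def, intro cadlag_on_sum cad)
    qed
  qed
qed

end

theorem theorem4p1:
  fixes M :: "'w measure"
    and e :: "nat \<Rightarrow> 'h::{real_inner, banach, second_countable_topology}" and z :: 'h
    and \<gamma> \<sigma> b :: "nat \<Rightarrow> real" and \<nu> :: "nat \<Rightarrow> real measure"
    and L X :: "nat \<Rightarrow> real \<Rightarrow> 'w \<Rightarrow> real" and Y :: "real \<Rightarrow> 'w \<Rightarrow> real"
    and \<epsilon> :: real
  assumes "prob_space M"
    and "orthonormal_basis e"
    and "\<And>n. \<gamma> n > 0"
    and "\<And>n. \<sigma> n \<ge> 0"
    and "\<And>n. symmetric_levy_measure (\<nu> n)"
    and "\<And>n. symmetric_pure_jump_levy_process M (\<nu> n) (L n)"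
    and "indep_processes M L"
    and "\<And>n t. t \<in> {0..1} \<Longrightarrow>
          is_stochastic_integral M (\<lambda>s. exp (- \<gamma> n * (t - s)) * \<sigma> n) (L n) t (X n t)"
    and "\<And>n. AE \<omega> in M. cadlag_on {0..1} (\<lambda>t. X n t \<omega>)"
    and "\<And>n. b n = \<bar>\<sigma> n * (z \<bullet> e n)\<bar>"
    and "\<And>t. t \<in> {0..1} \<Longrightarrow> AE \<omega> in M. summable (\<lambda>n. (z \<bullet> e n) * X n t \<omega>)"
    and "\<And>t \<omega>. Y t \<omega> = (\<Sum>n. (z \<bullet> e n) * X n t \<omega>)"
    and "\<epsilon> > 0"
    and "(\<Sum>n. emeasure (\<nu> n) (if b n = 0 then {} else {\<epsilon> / b n ..})) < \<infinity>"
    and "(\<Sum>n. if b n = 0 then 0 else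
            ennreal ((b n)\<^sup>2) * (\<integral>\<^sup>+ y \<in> {y. b n * \<bar>y\<bar> \<le> \<epsilon>}. ennreal (\<bar>y\<bar>\<^sup>2) \<partial>\<nu> n)) < \<infinity>"
  shows "has_cadlag_modification M {0..1} Y"
proof -
  define K where "K n = (\<integral>\<^sup>+y. ennreal (min 1 (((z \<bullet> e n) * \<sigma> n * y)\<^sup>2)) \<partial>\<nu> n)" for n
  define \<kappa> where "\<kappa> n = enn2real (K n)" for n
  let ?large = "\<lambda>n. emeasure (\<nu> n) (if b n = 0 then {} else {\<epsilon> / b n ..})"
  let ?small = "\<lambda>n. if b n = 0 then 0 else
            ennreal ((b n)\<^sup>2) * (\<integral>\<^sup>+ y \<in> {y. b n * \<bar>y\<bar> \<le> \<epsilon>}. ennreal (\<bar>y\<bar>\<^sup>2) \<partial>\<nu> n)"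
  \<comment> \<open>The two series of the hypotheses add up to a bound on the truncated second moments.\<close>
  have "K n \<le> ?small n + 2 * ?large n" for n
  proof (cases "b n = 0")
    case True
    then have "(z \<bullet> e n) * \<sigma> n = 0" by (auto simp: assms(10))
    then have "K n = 0" unfolding K_def by (simp only: mult_zero_left) simp
    then show ?thesis by simp
  next
    case False
    then have "0 < b n" "\<bar>(z \<bullet> e n) * \<sigma> n\<bar> = b n"
      by (auto simp: assms(10) mult.commute)
    from nn_integral_min_square_le_split[OF assms(5,13) this] False
    show ?thesis by (simp add: K_def)
  qed
  then have "(\<Sum>n. K n) \<le> (\<Sum>n. ?small n + 2 * ?large n)"
    by (intro suminf_le) auto
  also have "\<dots> = (\<Sum>n. ?small n) + 2 * (\<Sum>n. ?large n)"
    by (simp add: suminf_add[symmetric] ennreal_suminf_cmult)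
  also have "\<dots> < \<infinity>"
    using assms(14,15) by (simp add: ennreal_mult_less_top)
  finally have K_fin: "(\<Sum>n. K n) < \<infinity>" .
  have "K n < \<infinity>" for n
    using sum_le_suminf[of K "{n}"] K_fin by (auto intro: le_less_trans)
  then have K: "K n = ennreal (\<kappa> n)" for n by (simp add: \<kappa>_def)
  have \<kappa>_nonneg: "0 \<le> \<kappa> n" for n by (simp add: \<kappa>_def)
  have \<kappa>_summable: "summable \<kappa>"
    by (rule summable_suminf_not_top) (use K_fin[unfolded K] \<kappa>_nonneg in auto)
  interpret prob_space M by (rule assms(1))
  interpret levy_driven_series M L X \<nu> \<gamma> \<sigma> "\<lambda>n. z \<bullet> e n" \<kappa>
  proof unfold_locales
    show "0 \<le> \<gamma> n" for n using assms(3)[of n] by simp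
  qed (fact assms(5-7) K[unfolded K_def] \<kappa>_nonneg | rule assms(8), assumption)+
  have "Y = (\<lambda>t \<omega>. \<Sum>n. (z \<bullet> e n) * X n t \<omega>)" by (intro ext assms(12))
  then show ?thesis
    using has_cadlag_modification_series[OF \<kappa>_summable assms(9,11)] by simp
qed

end
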